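(* Let $G$ be a discrete group acting properly on a space $M$, let $H<G$ be a finite (not necessarily normal) subgroup with normalizer $N(H)$ in $G$, and let $\rho$ be a representation of $H$. Then, with the categories defined in the context, $$\widetilde{\mathrm{Vect}}_G(M,\rho)\approx \mathrm{Vect}_{N(H)}(M^H,\rho).$$
   Context: $M^K$ and $\xi^K$ denote the sets of fixed points of a subgroup $K$ in $M$ and in the total space of a bundle $\xi$. Write $\rho=\bigoplus_k\mathrm{Id}_{F_k}\otimes\rho_k$ on $\bigoplus_kF_k\otimes V_k$, where $k$ runs over all irreducible unitary representations $\rho_k:H\to\mathrm{U}(V_k)$ of $H$ and the $F_k$ are fixed finite-dimensional vector spaces. $\widetilde{\mathrm{Vect}}_G(M,\rho)$ is the category of $G$-equivariant vector bundles $\xi$ over $M$ with quasi-free action of $G$ with (non-normal) stationary subgroup $H$, that is: (a) $M=\bigcup_{[g]\in G/N(H)}M^{gHg^{-1}}$; (b) there are no fixed points of the conjugates of $H$ in the total space of $\xi$ other than those in the base (zero section) $M$; (c) $H$ is the unique, up to conjugation, maximal subgroup for $\xi$: in the family $\mathfrak F_\xi=\{K<G:\ \xi^K\neq\emptyset\}$, ordered by inclusion, every conjugate $gHg^{-1}$ is maximal, and there are no other maximal elements; and such that the restriction of $\xi$ to $M^H$ has type $\rho$, i.e. it is an object of $\mathrm{Vect}_{N(H)}(M^H,\rho)$. $\mathrm{Vect}_{N(H)}(M^H,\rho)$ is the category of $N(H)$-equivariant vector bundles over $M^H$, with quasi-free action of $N(H)$ over the base and normal stationary subgroup $H$ ($H$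 acts trivially on $M^H$ and $N(H)/H$ acts freely), without fixed points of $H$ in the total space other than those in the base, which split as a sum $\bigoplus_k\xi_k$ of $N(H)$-subbundles, where, as an $H$-bundle, $\xi_k\approx\eta_k\otimes V_k$, with $\eta_k$ a vector bundle with fibre $F_k$ and trivial $H$-action, and $V_k$ the trivial bundle with fibre $V_k$ and fibrewise action of $H$ by $\rho_k$.
   Formalization: The formal theorem also assumes that M satisfies (a) and that the conjugates of H are exactly the maximal subgroups with fixed points in M; otherwise the left category is empty while the right one need not be (S_3 on a point, H of order 2). Total spaces lie in a fixed large enough set. *)

theory Defs
  imports
    "HOL-Analysis.Function_Topology"
    "HOL-Analysis.Product_Topology"
    "HOL-Algebra.Group_Action"
    "Jordan_Normal_Form.VS_Connect"
    "Jordan_Normal_Form.Schur_Decomposition"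
begin

hide_const (open) Multiset.mult Polynomial.smult Modules.module

section \<open>Categories and their equivalence\<close>

text \<open>Hom-sets need not be disjoint; composition and identities therefore carry the objects as
  arguments. \<open>Comp C x y z g f\<close> is the composite of \<open>f : x \<rightarrow> y\<close> followed by \<open>g : y \<rightarrow> z\<close>.\<close>

record ('o, 'a) cat =
  Obj :: "'o set"
  Hom :: "'o \<Rightarrow> 'o \<Rightarrow> 'a set"
  Ident :: "'o \<Rightarrow> 'a"
  Comp :: "'o \<Rightarrow> 'o \<Rightarrow> 'o \<Rightarrow> 'a \<Rightarrow> 'a \<Rightarrow> 'a"

definition category :: "('o, 'a) cat \<Rightarrow> bool" where
  "category C \<longleftrightarrow>
     (\<forall>x\<in>Obj C. Ident C x \<in> Hom C x x) \<and>
     (\<forall>x\<in>Obj C. \<forall>y\<in>Obj C. \<forall>z\<in>Obj C. \<forall>f\<in>Hom C x y. \<forall>g\<in>Hom C y z.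
        Comp C x y z g f \<in> Hom C x z) \<and>
     (\<forall>x\<in>Obj C. \<forall>y\<in>Obj C. \<forall>f\<in>Hom C x y.
        Comp C x x y f (Ident C x) = f \<and> Comp C x y y (Ident C y) f = f) \<and>
     (\<forall>w\<in>Obj C. \<forall>x\<in>Obj C. \<forall>y\<in>Obj C. \<forall>z\<in>Obj C.
        \<forall>f\<in>Hom C w x. \<forall>g\<in>Hom C x y. \<forall>h\<in>Hom C y z.
        Comp C w y z h (Comp C w x y g f) = Comp C w x z (Comp C x y z h g) f)"

definition is_functor ::
  "('o, 'a) cat \<Rightarrow> ('p, 'b) cat \<Rightarrow> ('o \<Rightarrow> 'p) \<Rightarrow> ('o \<Rightarrow> 'o \<Rightarrow> 'a \<Rightarrow> 'b) \<Rightarrow> bool" where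
  "is_functor C D F0 F1 \<longleftrightarrow>
     (\<forall>x\<in>Obj C. F0 x \<in> Obj D) \<and>
     (\<forall>x\<in>Obj C. \<forall>y\<in>Obj C. \<forall>f\<in>Hom C x y. F1 x y f \<in> Hom D (F0 x) (F0 y)) \<and>
     (\<forall>x\<in>Obj C. F1 x x (Ident C x) = Ident D (F0 x)) \<and>
     (\<forall>x\<in>Obj C. \<forall>y\<in>Obj C. \<forall>z\<in>Obj C. \<forall>f\<in>Hom C x y. \<forall>g\<in>Hom C y z.
        F1 x z (Comp C x y z g f) = Comp D (F0 x) (F0 y) (F0 z) (F1 y z g) (F1 x y f))"

definition cat_iso :: "('o, 'a) cat \<Rightarrow> 'o \<Rightarrow> 'o \<Rightarrow> 'a \<Rightarrow> bool" where
  "cat_iso C x y f \<longleftrightarrow> f \<in> Hom C x y \<and>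
     (\<exists>g\<in>Hom C y x. Comp C x y x g f = Ident C x \<and> Comp C y x y f g = Ident C y)"

definition natural_iso ::
  "('o, 'a) cat \<Rightarrow> ('p, 'b) cat \<Rightarrow> ('o \<Rightarrow> 'p) \<Rightarrow> ('o \<Rightarrow> 'o \<Rightarrow> 'a \<Rightarrow> 'b) \<Rightarrow>
   ('o \<Rightarrow> 'p) \<Rightarrow> ('o \<Rightarrow> 'o \<Rightarrow> 'a \<Rightarrow> 'b) \<Rightarrow> ('o \<Rightarrow> 'b) \<Rightarrow> bool" where
  "natural_iso C D F0 F1 K0 K1 \<tau> \<longleftrightarrow>
     (\<forall>x\<in>Obj C. cat_iso D (F0 x) (K0 x) (\<tau> x)) \<and>
     (\<forall>x\<in>Obj C. \<forall>y\<in>Obj C. \<forall>f\<in>Hom C x y.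
        Comp D (F0 x) (F0 y) (K0 y) (\<tau> y) (F1 x y f) =
        Comp D (F0 x) (K0 x) (K0 y) (K1 x y f) (\<tau> x))"

definition equivalent_categories :: "('o, 'a) cat \<Rightarrow> ('p, 'b) cat \<Rightarrow> bool" where
  "equivalent_categories C D \<longleftrightarrow> category C \<and> category D \<and>
     (\<exists>F0 F1 K0 K1 \<sigma> \<tau>. is_functor C D F0 F1 \<and> is_functor D C K0 K1 \<and>
        natural_iso C C (\<lambda>x. x) (\<lambda>x y f. f) (\<lambda>x. K0 (F0 x)) (\<lambda>x y f. K1 (F0 x) (F0 y) (F1 x y f)) \<sigma> \<and>
        natural_iso D D (\<lambda>x. F0 (K0 x)) (\<lambda>x y f. F1 (K0 x) (K0 y) (K1 x y f)) (\<lambda>x. x) (\<lambda>x y f. f) \<tau>)"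


section \<open>Actions of a discrete group\<close>

definition G_space :: "('g, 'z) monoid_scheme \<Rightarrow> 'm topology \<Rightarrow> ('g \<Rightarrow> 'm \<Rightarrow> 'm) \<Rightarrow> bool" where
  "G_space G X \<phi> \<longleftrightarrow>
     group_action G (topspace X) \<phi> \<and> (\<forall>g\<in>carrier G. continuous_map X X (\<phi> g))"

text \<open>Properness in the sense of Bourbaki.\<close>

definition proper_G_space :: "('g, 'z) monoid_scheme \<Rightarrow> 'm topology \<Rightarrow> ('g \<Rightarrow> 'm \<Rightarrow> 'm) \<Rightarrow> bool" where
  "proper_G_space G X \<phi> \<longleftrightarrow> G_space G X \<phi> \<and>
     proper_map (prod_topology (discrete_topology (carrier G)) X) (prod_topology X X)
       (\<lambda>(g, x). (\<phi> g x, x))"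

definition fixed_points :: "'x set \<Rightarrow> ('g \<Rightarrow> 'x \<Rightarrow> 'x) \<Rightarrow> 'g set \<Rightarrow> 'x set" where
  "fixed_points E \<alpha> K = {e \<in> E. \<forall>k\<in>K. \<alpha> k e = e}"

definition restrict_action :: "('g \<Rightarrow> 'x \<Rightarrow> 'x) \<Rightarrow> 'x set \<Rightarrow> 'g \<Rightarrow> 'x \<Rightarrow> 'x" where
  "restrict_action \<alpha> S = (\<lambda>g. restrict (\<alpha> g) S)"

definition conjugate_subgroup :: "('g, 'z) monoid_scheme \<Rightarrow> 'g set \<Rightarrow> 'g \<Rightarrow> 'g set" where
  "conjugate_subgroup G H g = (g <#\<^bsub>G\<^esub> H) #>\<^bsub>G\<^esub> (inv\<^bsub>G\<^esub> g)"

abbreviation subgroup_of :: "('g, 'z) monoid_scheme \<Rightarrow> 'g set \<Rightarrow> ('g, 'z) monoid_scheme" where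
  "subgroup_of G K \<equiv> G\<lparr>carrier := K\<rparr>"

text \<open>The set fixed by \<open>gHg\<^sup>-\<^sup>1\<close> depends only on the class of \<open>g\<close> modulo the normalizer, so the union
  over the classes is the union over all \<open>g\<close>.\<close>

definition covered_by_fixed_points ::
  "('g, 'z) monoid_scheme \<Rightarrow> 'x set \<Rightarrow> ('g \<Rightarrow> 'x \<Rightarrow> 'x) \<Rightarrow> 'g set \<Rightarrow> bool" where
  "covered_by_fixed_points G E \<alpha> H \<longleftrightarrow>
     E = (\<Union>g\<in>carrier G. fixed_points E \<alpha> (conjugate_subgroup G H g))"

definition fixing_family :: "('g, 'z) monoid_scheme \<Rightarrow> 'x set \<Rightarrow> ('g \<Rightarrow> 'x \<Rightarrow> 'x) \<Rightarrow> 'g set set" where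
  "fixing_family G E \<alpha> = {K. subgroup K G \<and> fixed_points E \<alpha> K \<noteq> {}}"

definition unique_maximal_up_to_conjugation ::
  "('g, 'z) monoid_scheme \<Rightarrow> 'x set \<Rightarrow> ('g \<Rightarrow> 'x \<Rightarrow> 'x) \<Rightarrow> 'g set \<Rightarrow> bool" where
  "unique_maximal_up_to_conjugation G E \<alpha> H \<longleftrightarrow>
     {K \<in> fixing_family G E \<alpha>. \<forall>L\<in>fixing_family G E \<alpha>. K \<subseteq> L \<longrightarrow> L = K} =
     conjugate_subgroup G H ` carrier G"


section \<open>Equivariant complex vector bundles\<close>

record ('e, 'm) vbundle =
  total :: "'e topology"
  proj :: "'e \<Rightarrow> 'm"
  fzero :: "'m \<Rightarrow> 'e"
  fadd :: "'e \<Rightarrow> 'e \<Rightarrow> 'e"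
  fsmult :: "complex \<Rightarrow> 'e \<Rightarrow> 'e"

record ('e, 'm, 'g) gbundle = "('e, 'm) vbundle" +
  act :: "'g \<Rightarrow> 'e \<Rightarrow> 'e"

text \<open>Rings are part of the module record, so a fibre has two meaningless fields.\<close>

definition fibre :: "('e, 'm, 'z) vbundle_scheme \<Rightarrow> 'm \<Rightarrow> (complex, 'e) module" where
  "fibre \<xi> x = \<lparr>carrier = {e \<in> topspace (total \<xi>). proj \<xi> e = x},
     mult = undefined, one = undefined,
     zero = fzero \<xi> x, add = fadd \<xi>, smult = fsmult \<xi>\<rparr>"

definition coord_top :: "nat \<Rightarrow> (nat \<Rightarrow> complex) topology" where
  "coord_top n = product_topology (\<lambda>_. euclidean) {..<n}"

definition coord_space :: "nat \<Rightarrow> (complex, nat \<Rightarrow> complex) module" where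
  "coord_space n = \<lparr>carrier = {..<n} \<rightarrow>\<^sub>E UNIV,
     mult = undefined, one = undefined,
     zero = (\<lambda>i\<in>{..<n}. 0), add = (\<lambda>v w. \<lambda>i\<in>{..<n}. v i + w i),
     smult = (\<lambda>c v. \<lambda>i\<in>{..<n}. c * v i)\<rparr>"

definition trivialization ::
  "nat \<Rightarrow> 'm topology \<Rightarrow> ('e, 'm, 'z) vbundle_scheme \<Rightarrow> 'm set \<Rightarrow> ('e \<Rightarrow> 'm \<times> (nat \<Rightarrow> complex)) \<Rightarrow> bool" where
  "trivialization n X \<xi> U \<Phi> \<longleftrightarrow>
     homeomorphic_map
       (subtopology (total \<xi>) {e \<in> topspace (total \<xi>). proj \<xi> e \<in> U})
       (prod_topology (subtopology X U) (coord_top n)) \<Phi> \<and>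
     (\<forall>e\<in>topspace (total \<xi>). proj \<xi> e \<in> U \<longrightarrow> fst (\<Phi> e) = proj \<xi> e) \<and>
     (\<forall>x\<in>U. (\<lambda>e. snd (\<Phi> e)) \<in> module_hom class_ring (fibre \<xi> x) (coord_space n))"

definition vector_bundle :: "'m topology \<Rightarrow> ('e, 'm, 'z) vbundle_scheme \<Rightarrow> bool" where
  "vector_bundle X \<xi> \<longleftrightarrow>
     continuous_map (total \<xi>) X (proj \<xi>) \<and>
     (\<forall>x\<in>topspace X. vectorspace class_ring (fibre \<xi> x)) \<and>
     (\<forall>x\<in>topspace X. \<exists>n U \<Phi>. openin X U \<and> x \<in> U \<and> trivialization n X \<xi> U \<Phi>)"

definition vector_bundle_of_rank :: "nat \<Rightarrow> 'm topology \<Rightarrow> ('e, 'm, 'z) vbundle_scheme \<Rightarrow> bool" where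
  "vector_bundle_of_rank n X \<xi> \<longleftrightarrow> vector_bundle X \<xi> \<and>
     (\<forall>x\<in>topspace X. \<exists>U \<Phi>. openin X U \<and> x \<in> U \<and> trivialization n X \<xi> U \<Phi>)"

definition equivariant_bundle ::
  "('g, 'z) monoid_scheme \<Rightarrow> 'm topology \<Rightarrow> ('g \<Rightarrow> 'm \<Rightarrow> 'm) \<Rightarrow> ('e, 'm, 'g) gbundle \<Rightarrow> bool" where
  "equivariant_bundle G X \<phi> \<xi> \<longleftrightarrow>
     vector_bundle X \<xi> \<and> G_space G (total \<xi>) (act \<xi>) \<and>
     (\<forall>g\<in>carrier G. \<forall>x\<in>topspace X.
        act \<xi> g \<in> module_hom class_ring (fibre \<xi> x) (fibre \<xi> (\<phi> g x)))"

definition sub_gbundle :: "('e, 'm, 'g) gbundle \<Rightarrow> 'e set \<Rightarrow> ('e, 'm, 'g) gbundle" where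
  "sub_gbundle \<xi> S = \<xi>\<lparr>total := subtopology (total \<xi>) S,
     act := restrict_action (act \<xi>) (topspace (total \<xi>) \<inter> S)\<rparr>"

definition restrict_to_base :: "('e, 'm, 'g) gbundle \<Rightarrow> 'm set \<Rightarrow> ('e, 'm, 'g) gbundle" where
  "restrict_to_base \<xi> A = sub_gbundle \<xi> {e \<in> topspace (total \<xi>). proj \<xi> e \<in> A}"

definition fixed_only_in_zero_section :: "('e, 'm, 'g) gbundle \<Rightarrow> 'g set \<Rightarrow> bool" where
  "fixed_only_in_zero_section \<xi> K \<longleftrightarrow>
     (\<forall>e\<in>fixed_points (topspace (total \<xi>)) (act \<xi>) K. e = fzero \<xi> (proj \<xi> e))"

text \<open>Isomorphism of bundles over \<open>X\<close> for a group acting trivially on \<open>X\<close>; the total spaces may have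
  different types.\<close>

definition isomorphic_bundles ::
  "('g, 'z) monoid_scheme \<Rightarrow> 'm topology \<Rightarrow> ('e, 'm, 'g) gbundle \<Rightarrow> ('f, 'm, 'g) gbundle \<Rightarrow> bool" where
  "isomorphic_bundles G X \<xi> \<zeta> \<longleftrightarrow> (\<exists>f. homeomorphic_map (total \<xi>) (total \<zeta>) f \<and>
     (\<forall>x\<in>topspace X. f \<in> module_hom class_ring (fibre \<xi> x) (fibre \<zeta> x)) \<and>
     (\<forall>g\<in>carrier G. \<forall>e\<in>topspace (total \<xi>). f (act \<xi> g e) = act \<zeta> g (f e)))"

text \<open>Morphisms cover the identity of the base; they are extensional functions on the total space
  so that equality of morphisms is equality of maps of total spaces.\<close>

definition bundle_hom ::
  "('g, 'z) monoid_scheme \<Rightarrow> 'm topology \<Rightarrow> ('e, 'm, 'g) gbundle \<Rightarrow> ('e, 'm, 'g) gbundle \<Rightarrow> ('e \<Rightarrow> 'e) set" where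
  "bundle_hom G X \<xi> \<zeta> = {f \<in> extensional (topspace (total \<xi>)).
     continuous_map (total \<xi>) (total \<zeta>) f \<and>
     (\<forall>x\<in>topspace X. f \<in> module_hom class_ring (fibre \<xi> x) (fibre \<zeta> x)) \<and>
     (\<forall>g\<in>carrier G. \<forall>e\<in>topspace (total \<xi>). f (act \<xi> g e) = act \<zeta> g (f e))}"

definition bundle_cat ::
  "('g, 'z) monoid_scheme \<Rightarrow> 'm topology \<Rightarrow> ('e, 'm, 'g) gbundle set \<Rightarrow> (('e, 'm, 'g) gbundle, 'e \<Rightarrow> 'e) cat" where
  "bundle_cat G X \<O> = \<lparr>Obj = \<O>, Hom = bundle_hom G X,
     Ident = (\<lambda>\<xi>. \<lambda>e\<in>topspace (total \<xi>). e),
     Comp = (\<lambda>\<xi> \<zeta> \<chi> g f. compose (topspace (total \<xi>)) g f)\<rparr>"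


section \<open>Unitary representations\<close>

definition unitary_group :: "nat \<Rightarrow> complex mat monoid" where
  "unitary_group n = \<lparr>carrier = {A \<in> carrier_mat n n.
       A * mat_adjoint A = 1\<^sub>m n \<and> mat_adjoint A * A = 1\<^sub>m n},
     mult = (*), one = 1\<^sub>m n\<rparr>"

definition unitary_irrep :: "('g, 'z) monoid_scheme \<Rightarrow> nat \<Rightarrow> ('g \<Rightarrow> complex mat) \<Rightarrow> bool" where
  "unitary_irrep H n \<sigma> \<longleftrightarrow> 0 < n \<and> \<sigma> \<in> hom H (unitary_group n) \<and>
     (\<forall>W. VectorSpace.subspace class_ring W (module_vec TYPE(complex) n) \<and>
          (\<forall>h\<in>carrier H. \<forall>w\<in>W. \<sigma> h *\<^sub>v w \<in> W) \<longrightarrow>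
        W = {0\<^sub>v n} \<or> W = carrier_vec n)"

definition unitarily_equivalent ::
  "('g, 'z) monoid_scheme \<Rightarrow> nat \<Rightarrow> ('g \<Rightarrow> complex mat) \<Rightarrow> nat \<Rightarrow> ('g \<Rightarrow> complex mat) \<Rightarrow> bool" where
  "unitarily_equivalent H n \<sigma> m \<tau> \<longleftrightarrow>
     n = m \<and> (\<exists>U\<in>carrier (unitary_group n). \<forall>h\<in>carrier H. U * \<sigma> h = \<tau> h * U)"

text \<open>The data of \<open>\<rho> = \<Oplus>\<^sub>k Id \<otimes> \<rho>\<^sub>k\<close> on \<open>\<Oplus>\<^sub>k F\<^sub>k \<otimes> V\<^sub>k\<close>. Orthonormal bases are chosen, so that
  \<open>V\<^sub>k\<close> is \<open>\<complex>\<close> to the power \<open>irr_dim \<rho> k\<close> and \<open>F\<^sub>k\<close> is \<open>\<complex>\<close> to the power \<open>mult_dim \<rho> k\<close>, possibly 0.\<close>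

record ('k, 'g) rep_data =
  irr_index :: "'k set"
  irr_dim :: "'k \<Rightarrow> nat"
  irr :: "'k \<Rightarrow> 'g \<Rightarrow> complex mat"
  mult_dim :: "'k \<Rightarrow> nat"

text \<open>Each equivalence class of irreducible unitary representations is listed exactly once.\<close>

definition representation_data :: "('g, 'z) monoid_scheme \<Rightarrow> ('k, 'g) rep_data \<Rightarrow> bool" where
  "representation_data H \<rho> \<longleftrightarrow> finite (irr_index \<rho>) \<and>
     (\<forall>k\<in>irr_index \<rho>. unitary_irrep H (irr_dim \<rho> k) (irr \<rho> k)) \<and>
     (\<forall>k\<in>irr_index \<rho>. \<forall>l\<in>irr_index \<rho>.
        unitarily_equivalent H (irr_dim \<rho> k) (irr \<rho> k) (irr_dim \<rho> l) (irr \<rho> l) \<longrightarrow> k = l) \<and>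
     (\<forall>n \<sigma>. unitary_irrep H n \<sigma> \<longrightarrow>
        (\<exists>k\<in>irr_index \<rho>. unitarily_equivalent H n \<sigma> (irr_dim \<rho> k) (irr \<rho> k)))"

text \<open>\<open>\<eta> \<otimes> V\<close> for the trivial bundle \<open>V\<close> with fibre \<open>\<complex>\<^sup>d\<close>, standard basis \<open>b\<^sub>0, \<dots>\<close>: the tuple \<open>s\<close>
  stands for \<open>\<Sum>\<^sub>j s\<^sub>j \<otimes> b\<^sub>j\<close>, and \<open>h\<close> acts as \<open>Id \<otimes> \<sigma> h\<close>, i.e. \<open>h\<close> is trivial on \<open>\<eta>\<close>. Meant for \<open>d > 0\<close>.\<close>

definition tensor_rep ::
  "('e, 'm) vbundle \<Rightarrow> nat \<Rightarrow> ('g \<Rightarrow> complex mat) \<Rightarrow> (nat \<Rightarrow> 'e, 'm, 'g) gbundle" where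
  "tensor_rep \<eta> d \<sigma> =
     \<lparr>total = subtopology (product_topology (\<lambda>_. total \<eta>) {..<d})
                {s. \<forall>i<d. proj \<eta> (s i) = proj \<eta> (s 0)},
      proj = (\<lambda>s. proj \<eta> (s 0)),
      fzero = (\<lambda>x. \<lambda>i\<in>{..<d}. fzero \<eta> x),
      fadd = (\<lambda>s t. \<lambda>i\<in>{..<d}. fadd \<eta> (s i) (t i)),
      fsmult = (\<lambda>c s. \<lambda>i\<in>{..<d}. fsmult \<eta> c (s i)),
      act = (\<lambda>h s. \<lambda>i\<in>{..<d}.
        finsum (fibre \<eta> (proj \<eta> (s 0))) (\<lambda>j. fsmult \<eta> (\<sigma> h $$ (i, j)) (s j)) {..<d})\<rparr>"


section \<open>The two categories of bundles\<close>

text \<open>The total spaces of the objects live in a fixed type \<open>'e\<close>. Up to isomorphism this excludes no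
  bundle over the base \<open>X :: 'm topology\<close> as soon as \<open>'m \<times> complex\<close> injects into \<open>'e\<close>.\<close>

text \<open>Whenever \<open>\<eta> \<otimes> V\<^sub>k\<close> is isomorphic to a bundle \<open>\<xi>\<^sub>k\<close>, the bundle \<open>\<eta>\<close> embeds into \<open>\<xi>\<^sub>k\<close>;
  so it is no restriction to take the total space of \<open>\<eta>\<close> in the type of that of \<open>\<xi>\<close>.\<close>

definition has_type ::
  "('g, 'z) monoid_scheme \<Rightarrow> 'm topology \<Rightarrow> ('g \<Rightarrow> 'm \<Rightarrow> 'm) \<Rightarrow> 'g set \<Rightarrow> ('k, 'g) rep_data \<Rightarrow>
   ('e, 'm, 'g) gbundle \<Rightarrow> bool" where
  "has_type N Y \<psi> H \<rho> \<xi> \<longleftrightarrow>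
     (\<exists>S. (\<forall>k\<in>irr_index \<rho>. S k \<subseteq> topspace (total \<xi>) \<and>
             equivariant_bundle N Y \<psi> (sub_gbundle \<xi> (S k)) \<and>
             (\<exists>\<eta> :: ('e, 'm) vbundle. vector_bundle_of_rank (mult_dim \<rho> k) Y \<eta> \<and>
                isomorphic_bundles (subgroup_of N H) Y
                  (sub_gbundle \<xi> (S k)) (tensor_rep \<eta> (irr_dim \<rho> k) (irr \<rho> k)))) \<and>
          (\<forall>y\<in>topspace Y. \<forall>e\<in>carrier (fibre \<xi> y).
             \<exists>!s. s \<in> (\<Pi>\<^sub>E k\<in>irr_index \<rho>. carrier (fibre (sub_gbundle \<xi> (S k)) y)) \<and>
                  e = finsum (fibre \<xi> y) s (irr_index \<rho>)))"

text \<open>The clause on \<open>\<psi> g y = y\<close> is freeness of the induced action of \<open>N\<close> modulo \<open>H\<close>.\<close>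

definition quasi_free_normal ::
  "('g, 'z) monoid_scheme \<Rightarrow> 'm topology \<Rightarrow> ('g \<Rightarrow> 'm \<Rightarrow> 'm) \<Rightarrow> 'g set \<Rightarrow> bool" where
  "quasi_free_normal N Y \<psi> H \<longleftrightarrow> G_space N Y \<psi> \<and> normal H N \<and>
     (\<forall>h\<in>H. \<forall>y\<in>topspace Y. \<psi> h y = y) \<and>
     (\<forall>g\<in>carrier N. \<forall>y\<in>topspace Y. \<psi> g y = y \<longrightarrow> g \<in> H)"

definition Vect_normal ::
  "('g, 'z) monoid_scheme \<Rightarrow> 'm topology \<Rightarrow> ('g \<Rightarrow> 'm \<Rightarrow> 'm) \<Rightarrow> 'g set \<Rightarrow> ('k, 'g) rep_data \<Rightarrow>
   (('e, 'm, 'g) gbundle, 'e \<Rightarrow> 'e) cat" where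
  "Vect_normal N Y \<psi> H \<rho> = bundle_cat N Y
     {\<xi>. equivariant_bundle N Y \<psi> \<xi> \<and> quasi_free_normal N Y \<psi> H \<and>
         fixed_only_in_zero_section \<xi> H \<and> has_type N Y \<psi> H \<rho> \<xi>}"

definition Vect_normalizer ::
  "('g, 'z) monoid_scheme \<Rightarrow> 'm topology \<Rightarrow> ('g \<Rightarrow> 'm \<Rightarrow> 'm) \<Rightarrow> 'g set \<Rightarrow> ('k, 'g) rep_data \<Rightarrow>
   (('e, 'm, 'g) gbundle, 'e \<Rightarrow> 'e) cat" where
  "Vect_normalizer G X \<phi> H \<rho> =
     (let F = fixed_points (topspace X) \<phi> H in
      Vect_normal (subgroup_of G (normalizer G H)) (subtopology X F) (restrict_action \<phi> F) H \<rho>)"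

definition Vect_tilde ::
  "('g, 'z) monoid_scheme \<Rightarrow> 'm topology \<Rightarrow> ('g \<Rightarrow> 'm \<Rightarrow> 'm) \<Rightarrow> 'g set \<Rightarrow> ('k, 'g) rep_data \<Rightarrow>
   (('e, 'm, 'g) gbundle, 'e \<Rightarrow> 'e) cat" where
  "Vect_tilde G X \<phi> H \<rho> = bundle_cat G X
     {\<xi>. equivariant_bundle G X \<phi> \<xi> \<and>
         covered_by_fixed_points G (topspace X) \<phi> H \<and>
         (\<forall>g\<in>carrier G. fixed_only_in_zero_section \<xi> (conjugate_subgroup G H g)) \<and>
         unique_maximal_up_to_conjugation G (topspace (total \<xi>)) (act \<xi>) H \<and>
         restrict_to_base \<xi> (fixed_points (topspace X) \<phi> H) \<in> Obj (Vect_normalizer G X \<phi> H \<rho>)}"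

text \<open>The conditions on the base contained in the definition of the objects of \<open>Vect_tilde\<close>: the
  zero section and the projection are equivariant, so a subgroup has fixed points in the total space
  iff it has fixed points in the base. If they fail, \<open>Vect_tilde\<close> is empty, but \<open>Vect_normalizer\<close> need
  not be: take the symmetric group on three letters acting on a point and \<open>H\<close> of order 2.\<close>

definition quasi_free_base ::
  "('g, 'z) monoid_scheme \<Rightarrow> 'm topology \<Rightarrow> ('g \<Rightarrow> 'm \<Rightarrow> 'm) \<Rightarrow> 'g set \<Rightarrow> bool" where
  "quasi_free_base G X \<phi> H \<longleftrightarrow>
     covered_by_fixed_points G (topspace X) \<phi> H \<and>
     unique_maximal_up_to_conjugation G (topspace X) \<phi> H"

end

theory Submission
  imports Defs
begin

text \<open>Maximality in the family of fixing subgroups forces every isotropy group on \<open>X\<close> to be a conjugate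
  of \<open>H\<close>. Since the action is proper and the group discrete, isotropy groups can only shrink in a
  neighbourhood of a point; conjugates of the finite group \<open>H\<close> all have the same order, so they do
  not shrink and \<open>F = X\<^sup>H\<close> is open. Hence \<open>X\<close> is the disjoint union of the open translates \<open>gF\<close>, one
  for each class of \<open>g\<close> modulo \<open>N = N(H)\<close>, that is \<open>X = G \<times>\<^sub>N F\<close>.
  An equivariant morphism is therefore determined by its restriction to \<open>F\<close>, and any \<open>N\<close>-equivariant
  morphism over \<open>F\<close> extends by \<open>e \<mapsto> g f (g\<^sup>-\<^sup>1 e)\<close>: restriction to \<open>F\<close> is fully faithful. It is essentially
  surjective because \<open>G \<times>\<^sub>N \<zeta>\<close> restricts to \<open>\<zeta>\<close>. Its total space is realized without a quotient, as
  the pullback of \<open>\<zeta>\<close> along a locally constant retraction of \<open>X\<close> onto \<open>F\<close>.\<close>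

section \<open>Equivalences of categories\<close>

text \<open>Only the restriction functor is constructed; a quasi-inverse is obtained from it by
  choice. What shapes the rest is that the objects of both categories have their points in the one
  type \<open>'e\<close>, whereas the induced bundle has its points in
  \<open>'m \<times> 'e\<close>. It is moved into \<open>'e\<close> along an injection that exists
  for reasons of cardinality; the given injection of \<open>'m \<times> complex\<close> into
  \<open>'e\<close> serves this purpose. The restriction of the result is therefore isomorphic, not
  equal, to the given bundle over F, and the clauses that define the objects over F have to be
  invariant under isomorphism, including the decomposition into subbundles that realizes the type.
  Two clauses remain for the extended bundle itself. A point fixed by a conjugate of H is moved by
  the action to a point over F fixed by H, so the zero section condition is inherited from F; and
  the family of subgroups with fixed points is the same for total space and base, so the maximality
  condition is inherited from the base.\<close>

lemma fully_faithful_ess_surj_imp_equivalent: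
  assumes C: "category C" and D: "category D" and F: "is_functor C D F0 F1"
    and inj: "\<And>x y. x \<in> Obj C \<Longrightarrow> y \<in> Obj C \<Longrightarrow> inj_on (F1 x y) (Hom C x y)"
    and full: "\<And>x y g. x \<in> Obj C \<Longrightarrow> y \<in> Obj C \<Longrightarrow> g \<in> Hom D (F0 x) (F0 y) \<Longrightarrow> g \<in> F1 x y ` Hom C x y"
    and surj: "\<And>d. d \<in> Obj D \<Longrightarrow> \<exists>x\<in>Obj C. \<exists>f. cat_iso D (F0 x) d f"
  shows "equivalent_categories C D"
proof -
  have idC: "\<And>x. x \<in> Obj C \<Longrightarrow> Ident C x \<in> Hom C x x"
    and cC: "\<And>x y z f g. \<lbrakk>x \<in> Obj C; y \<in> Obj C; z \<in> Obj C; f \<in> Hom C x y; g \<in> Hom C y z\<rbrakk> \<Longrightarrow> Comp C x y z g f \<in> Hom C x z"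
    using C unfolding category_def by blast+
  have idD: "\<And>x. x \<in> Obj D \<Longrightarrow> Ident D x \<in> Hom D x x"
    and cD: "\<And>x y z f g. \<lbrakk>x \<in> Obj D; y \<in> Obj D; z \<in> Obj D; f \<in> Hom D x y; g \<in> Hom D y z\<rbrakk> \<Longrightarrow> Comp D x y z g f \<in> Hom D x z"
    and rD: "\<And>x y f. \<lbrakk>x \<in> Obj D; y \<in> Obj D; f \<in> Hom D x y\<rbrakk> \<Longrightarrow> Comp D x x y f (Ident D x) = f"
    and lD: "\<And>x y f. \<lbrakk>x \<in> Obj D; y \<in> Obj D; f \<in> Hom D x y\<rbrakk> \<Longrightarrow> Comp D x y y (Ident D y) f = f"
    and aD: "\<And>w x y z f g h. \<lbrakk>w \<in> Obj D; x \<in> Obj D; y \<in> Obj D; z \<in> Obj D; f \<in> Hom D w x; g \<in> Hom D x y; h \<in> Hom D y z\<rbrakk>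
        \<Longrightarrow> Comp D w y z h (Comp D w x y g f) = Comp D w x z (Comp D x y z h g) f"
    using D unfolding category_def by blast+
  have F0: "\<And>x. x \<in> Obj C \<Longrightarrow> F0 x \<in> Obj D"
    and F1: "\<And>x y f. \<lbrakk>x \<in> Obj C; y \<in> Obj C; f \<in> Hom C x y\<rbrakk> \<Longrightarrow> F1 x y f \<in> Hom D (F0 x) (F0 y)"
    and Fid: "\<And>x. x \<in> Obj C \<Longrightarrow> F1 x x (Ident C x) = Ident D (F0 x)"
    and Fc: "\<And>x y z f g. \<lbrakk>x \<in> Obj C; y \<in> Obj C; z \<in> Obj C; f \<in> Hom C x y; g \<in> Hom C y z\<rbrakk>
       \<Longrightarrow> F1 x z (Comp C x y z g f) = Comp D (F0 x) (F0 y) (F0 z) (F1 y z g) (F1 x y f)"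
    using F unfolding is_functor_def by blast+
  \<comment> \<open>The inverse is chosen together with the isomorphism, so that both become
    functions of \<open>d\<close> and arrows can be conjugated by them.\<close>
  have "\<forall>d\<in>Obj D. \<exists>x f g. x \<in> Obj C \<and> f \<in> Hom D (F0 x) d \<and> g \<in> Hom D d (F0 x) \<and>
      Comp D (F0 x) d (F0 x) g f = Ident D (F0 x) \<and> Comp D d (F0 x) d f g = Ident D d"
    using surj unfolding cat_iso_def by meson
  then obtain K0 t u where K: "\<And>d. d \<in> Obj D \<Longrightarrow> K0 d \<in> Obj C"
    and t: "\<And>d. d \<in> Obj D \<Longrightarrow> t d \<in> Hom D (F0 (K0 d)) d"
    and u: "\<And>d. d \<in> Obj D \<Longrightarrow> u d \<in> Hom D d (F0 (K0 d))"
    and ut: "\<And>d. d \<in> Obj D \<Longrightarrow> Comp D (F0 (K0 d)) d (F0 (K0 d)) (u d) (t d) = Ident D (F0 (K0 d))"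
    and tu: "\<And>d. d \<in> Obj D \<Longrightarrow> Comp D d (F0 (K0 d)) d (t d) (u d) = Ident D d"
    unfolding bchoice_iff by metis
  have FK: "\<And>d. d \<in> Obj D \<Longrightarrow> F0 (K0 d) \<in> Obj D" using F0 K by blast
  define P where "P x y h = inv_into (Hom C x y) (F1 x y) h" for x y h
  have P: "P x y h \<in> Hom C x y" "F1 x y (P x y h) = h"
    if "x \<in> Obj C" "y \<in> Obj C" "h \<in> Hom D (F0 x) (F0 y)" for x y h
    using full[OF that] unfolding P_def by (auto intro: inv_into_into f_inv_into_f)
  \<comment> \<open>The conjugate of \<open>f\<close> by the chosen isomorphisms; \<open>K1\<close>
    is its lift along the fully faithful functor, and \<open>tc\<close> is the naturality of
    \<open>t\<close> for this choice.\<close>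
  define c where "c d e f = Comp D (F0 (K0 d)) e (F0 (K0 e)) (u e) (Comp D (F0 (K0 d)) d e f (t d))" for d e f
  have c: "c d e f \<in> Hom D (F0 (K0 d)) (F0 (K0 e))" if "d \<in> Obj D" "e \<in> Obj D" "f \<in> Hom D d e" for d e f
    unfolding c_def using that t u FK by (meson cD)
  define K1 where "K1 d e f = P (K0 d) (K0 e) (c d e f)" for d e f
  have K1: "K1 d e f \<in> Hom C (K0 d) (K0 e)" "F1 (K0 d) (K0 e) (K1 d e f) = c d e f"
    if "d \<in> Obj D" "e \<in> Obj D" "f \<in> Hom D d e" for d e f
    using P[OF K K c] that unfolding K1_def by blast+
  have tc: "Comp D (F0 (K0 d)) (F0 (K0 e)) e (t e) (c d e f) = Comp D (F0 (K0 d)) d e f (t d)"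
    if d: "d \<in> Obj D" and e: "e \<in> Obj D" and f: "f \<in> Hom D d e" for d e f
  proof -
    have "Comp D (F0 (K0 d)) d e f (t d) \<in> Hom D (F0 (K0 d)) e" using that FK t by (meson cD)
    then have "Comp D (F0 (K0 d)) (F0 (K0 e)) e (t e) (c d e f) =
        Comp D (F0 (K0 d)) e e (Comp D e (F0 (K0 e)) e (t e) (u e)) (Comp D (F0 (K0 d)) d e f (t d))"
      unfolding c_def by (intro aD) (use that FK t u in auto)
    also have "\<dots> = Comp D (F0 (K0 d)) d e f (t d)"
      using \<open>Comp D (F0 (K0 d)) d e f (t d) \<in> _\<close> that FK by (simp add: tu lD)
    finally show ?thesis .
  qed
  \<comment> \<open>\<open>t e\<close> has the left inverse \<open>u e\<close>. Compatibility of
    \<open>K1\<close> with composition and naturality of \<open>s\<close> are thus checked after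
    composing with \<open>t e\<close>, where \<open>tc\<close> makes the arrows \<open>u\<close>
    disappear.\<close>
  have tcancel: "p = q" if "x \<in> Obj D" "e \<in> Obj D" "p \<in> Hom D x (F0 (K0 e))" "q \<in> Hom D x (F0 (K0 e))"
     "Comp D x (F0 (K0 e)) e (t e) p = Comp D x (F0 (K0 e)) e (t e) q" for x e p q
  proof -
    have "r = Comp D x e (F0 (K0 e)) (u e) (Comp D x (F0 (K0 e)) e (t e) r)"
      if "r \<in> Hom D x (F0 (K0 e))" for r
      using aD[OF \<open>x \<in> Obj D\<close> FK[OF \<open>e \<in> Obj D\<close>] \<open>e \<in> Obj D\<close> FK[OF \<open>e \<in> Obj D\<close>] that t[OF \<open>e \<in> Obj D\<close>] u[OF \<open>e \<in> Obj D\<close>]]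
        lD[OF \<open>x \<in> Obj D\<close> FK[OF \<open>e \<in> Obj D\<close>] that] ut[OF \<open>e \<in> Obj D\<close>] by simp
    then show ?thesis using that(3-5) by metis
  qed
  have Finj: "p = q" if "x \<in> Obj C" "y \<in> Obj C" "p \<in> Hom C x y" "q \<in> Hom C x y" "F1 x y p = F1 x y q" for x y p q
    using inj that by (meson inj_onD)
  have K1id: "K1 d d (Ident D d) = Ident C (K0 d)" if d: "d \<in> Obj D" for d
  proof (rule Finj)
    show "F1 (K0 d) (K0 d) (K1 d d (Ident D d)) = F1 (K0 d) (K0 d) (Ident C (K0 d))"
      using d by (simp add: K1 idD Fid K c_def lD FK t ut)
  qed (use d in \<open>auto simp: K K1 idD idC\<close>)
  have K1c: "K1 d h (Comp D d e h g f) = Comp C (K0 d) (K0 e) (K0 h) (K1 e h g) (K1 d e f)"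
    if d: "d \<in> Obj D" and e: "e \<in> Obj D" and h: "h \<in> Obj D" and f: "f \<in> Hom D d e" and g: "g \<in> Hom D e h" for d e h f g
  proof (rule Finj)
    let ?l = "c d h (Comp D d e h g f)" and ?r = "Comp D (F0 (K0 d)) (F0 (K0 e)) (F0 (K0 h)) (c e h g) (c d e f)"
    have gf: "Comp D d e h g f \<in> Hom D d h" using that cD by blast
    have "Comp D (F0 (K0 d)) (F0 (K0 h)) h (t h) ?l = Comp D (F0 (K0 d)) d h (Comp D d e h g f) (t d)"
      using tc[OF d h gf] .
    also have "\<dots> = Comp D (F0 (K0 d)) e h g (Comp D (F0 (K0 d)) d e f (t d))"
      by (rule aD[symmetric]) (use that FK t in auto)
    also have "\<dots> = Comp D (F0 (K0 d)) e h g (Comp D (F0 (K0 d)) (F0 (K0 e)) e (t e) (c d e f))"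
      using tc that by simp
    also have "\<dots> = Comp D (F0 (K0 d)) (F0 (K0 e)) h (Comp D (F0 (K0 e)) e h g (t e)) (c d e f)"
      by (rule aD) (use that FK t c in auto)
    also have "\<dots> = Comp D (F0 (K0 d)) (F0 (K0 e)) h (Comp D (F0 (K0 e)) (F0 (K0 h)) h (t h) (c e h g)) (c d e f)"
      using tc that by simp
    also have "\<dots> = Comp D (F0 (K0 d)) (F0 (K0 h)) h (t h) ?r"
      by (rule aD[symmetric]) (use that FK t c in auto)
    finally have "?l = ?r"
      by (rule tcancel[OF FK[OF d] h c[OF d h gf] cD[OF FK[OF d] FK[OF e] FK[OF h] c[OF d e f] c[OF e h g]]])
    then show "F1 (K0 d) (K0 h) (K1 d h (Comp D d e h g f)) =
       F1 (K0 d) (K0 h) (Comp C (K0 d) (K0 e) (K0 h) (K1 e h g) (K1 d e f))"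
      using that gf by (simp add: K1 Fc K)
  qed (use that K K1 cC cD in \<open>auto\<close>)
  have fK: "is_functor D C K0 K1"
    unfolding is_functor_def using K K1 K1id K1c by blast
  have cid: "cat_iso D (F0 (K0 d)) d (t d)" if "d \<in> Obj D" for d
    unfolding cat_iso_def using t u ut tu that by blast
  \<comment> \<open>The unit and its inverse lift \<open>u (F0 x)\<close> and
    \<open>t (F0 x)\<close>; by faithfulness the inverse laws reduce to \<open>tu\<close> and
    \<open>ut\<close>.\<close>
  define s where "s x = P x (K0 (F0 x)) (u (F0 x))" for x
  define s' where "s' x = P (K0 (F0 x)) x (t (F0 x))" for x
  have s: "s x \<in> Hom C x (K0 (F0 x))" "F1 x (K0 (F0 x)) (s x) = u (F0 x)"
    and s': "s' x \<in> Hom C (K0 (F0 x)) x" "F1 (K0 (F0 x)) x (s' x) = t (F0 x)" if "x \<in> Obj C" for x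
    unfolding s_def s'_def using that P K F0 t u by auto
  have siso: "cat_iso C x (K0 (F0 x)) (s x)" if x: "x \<in> Obj C" for x
  proof -
    have "Comp C x (K0 (F0 x)) x (s' x) (s x) = Ident C x"
      by (rule Finj[of x x]) (use x K F0 s s' cC idC in \<open>auto simp: Fc Fid tu\<close>)
    moreover have "Comp C (K0 (F0 x)) x (K0 (F0 x)) (s x) (s' x) = Ident C (K0 (F0 x))"
      by (rule Finj[of "K0 (F0 x)" "K0 (F0 x)"]) (use x K F0 s s' cC idC in \<open>auto simp: Fc Fid ut\<close>)
    ultimately show ?thesis unfolding cat_iso_def using s s' x by blast
  qed
  have snat: "Comp C x y (K0 (F0 y)) (s y) f = Comp C x (K0 (F0 x)) (K0 (F0 y)) (K1 (F0 x) (F0 y) (F1 x y f)) (s x)"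
    if x: "x \<in> Obj C" and y: "y \<in> Obj C" and f: "f \<in> Hom C x y" for x y f
  proof (rule Finj)
    let ?d = "F0 x" and ?e = "F0 y" and ?f = "F1 x y f"
    have d: "?d \<in> Obj D" and e: "?e \<in> Obj D" and f': "?f \<in> Hom D ?d ?e" using F0 F1 that by auto
    have "Comp D ?d (F0 (K0 ?e)) ?e (t ?e) (Comp D ?d ?e (F0 (K0 ?e)) (u ?e) ?f) = ?f"
      using aD[OF d e FK[OF e] e f' u[OF e] t[OF e]] lD[OF d e f'] tu[OF e] by simp
    also have "\<dots> = Comp D ?d ?d ?e ?f (Comp D ?d (F0 (K0 ?d)) ?d (t ?d) (u ?d))"
      using d e f' by (simp add: tu rD)
    also have "\<dots> = Comp D ?d (F0 (K0 ?d)) ?e (Comp D (F0 (K0 ?d)) ?d ?e ?f (t ?d)) (u ?d)"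
      by (rule aD) (use d e f' FK t u in auto)
    also have "\<dots> = Comp D ?d (F0 (K0 ?d)) ?e (Comp D (F0 (K0 ?d)) (F0 (K0 ?e)) ?e (t ?e) (c ?d ?e ?f)) (u ?d)"
      using tc d e f' by simp
    also have "\<dots> = Comp D ?d (F0 (K0 ?e)) ?e (t ?e) (Comp D ?d (F0 (K0 ?d)) (F0 (K0 ?e)) (c ?d ?e ?f) (u ?d))"
      by (rule aD[symmetric]) (use d e f' FK t u c in auto)
    finally have "Comp D ?d ?e (F0 (K0 ?e)) (u ?e) ?f = Comp D ?d (F0 (K0 ?d)) (F0 (K0 ?e)) (c ?d ?e ?f) (u ?d)"
      by (rule tcancel[OF d e cD[OF d e FK[OF e] f' u[OF e]] cD[OF d FK[OF d] FK[OF e] u[OF d] c[OF d e f']]])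
    then show "F1 x (K0 (F0 y)) (Comp C x y (K0 (F0 y)) (s y) f) =
      F1 x (K0 (F0 y)) (Comp C x (K0 (F0 x)) (K0 (F0 y)) (K1 (F0 x) (F0 y) (F1 x y f)) (s x))"
      using that d e f' by (simp add: Fc K s K1)
  qed (use that K F0 F1 s K1 cC in \<open>auto\<close>)
  have n1: "natural_iso C C (\<lambda>x. x) (\<lambda>x y f. f) (\<lambda>x. K0 (F0 x)) (\<lambda>x y f. K1 (F0 x) (F0 y) (F1 x y f)) s"
    unfolding natural_iso_def using siso snat by blast
  have n2: "natural_iso D D (\<lambda>x. F0 (K0 x)) (\<lambda>x y f. F1 (K0 x) (K0 y) (K1 x y f)) (\<lambda>x. x) (\<lambda>x y f. f) t"
    unfolding natural_iso_def using cid tc K1 by auto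
  show ?thesis
    unfolding equivalent_categories_def using C D F fK n1 n2 by blast
qed

section \<open>Equivariant bundles and their morphisms\<close>

lemma fibre_simps [simp]:
  "carrier (fibre \<xi> x) = {e \<in> topspace (total \<xi>). proj \<xi> e = x}"
  "zero (fibre \<xi> x) = fzero \<xi> x"
  "add (fibre \<xi> x) = fadd \<xi>"
  "smult (fibre \<xi> x) = fsmult \<xi>"
  by (simp_all add: fibre_def)

lemma carrier_class_ring [simp]: "carrier class_ring = UNIV"
  by (simp add: class_ring_simps)

lemma sub_gbundle_simps [simp]:
  "total (sub_gbundle \<xi> S) = subtopology (total \<xi>) S"
  "proj (sub_gbundle \<xi> S) = proj \<xi>"
  "fzero (sub_gbundle \<xi> S) = fzero \<xi>"
  "fadd (sub_gbundle \<xi> S) = fadd \<xi>"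
  "fsmult (sub_gbundle \<xi> S) = fsmult \<xi>"
  "act (sub_gbundle \<xi> S) = restrict_action (act \<xi>) (topspace (total \<xi>) \<inter> S)"
  by (simp_all add: sub_gbundle_def)

lemma restrict_to_base_simps [simp]:
  "topspace (total (restrict_to_base \<xi> A)) = {e \<in> topspace (total \<xi>). proj \<xi> e \<in> A}"
  "total (restrict_to_base \<xi> A) = subtopology (total \<xi>) {e \<in> topspace (total \<xi>). proj \<xi> e \<in> A}"
  "proj (restrict_to_base \<xi> A) = proj \<xi>"
  "fzero (restrict_to_base \<xi> A) = fzero \<xi>"
  "fadd (restrict_to_base \<xi> A) = fadd \<xi>"
  "fsmult (restrict_to_base \<xi> A) = fsmult \<xi>"
  "act (restrict_to_base \<xi> A) = restrict_action (act \<xi>) {e \<in> topspace (total \<xi>). proj \<xi> e \<in> A}"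
  by (auto simp: restrict_to_base_def intro!: arg_cong[where f = "restrict_action (act \<xi>)"])

section \<open>Linear maps between fibres and transport of vector space structure\<close>

lemma module_hom_class_ring:
  "f \<in> module_hom class_ring M N \<longleftrightarrow>
     (\<forall>v\<in>carrier M. f v \<in> carrier N) \<and>
     (\<forall>v\<in>carrier M. \<forall>w\<in>carrier M. f (v \<oplus>\<^bsub>M\<^esub> w) = f v \<oplus>\<^bsub>N\<^esub> f w) \<and>
     (\<forall>c. \<forall>v\<in>carrier M. f (c \<odot>\<^bsub>M\<^esub> v) = c \<odot>\<^bsub>N\<^esub> f v)"
  unfolding module_hom_def by auto

lemma module_hom_fibre:
  "f \<in> module_hom class_ring (fibre \<xi> x) (fibre \<zeta> y) \<longleftrightarrow>
     (\<forall>v\<in>topspace (total \<xi>). proj \<xi> v = x \<longrightarrow> f v \<in> topspace (total \<zeta>) \<and> proj \<zeta> (f v) = y) \<and>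
     (\<forall>v\<in>topspace (total \<xi>). \<forall>w\<in>topspace (total \<xi>). proj \<xi> v = x \<longrightarrow> proj \<xi> w = x \<longrightarrow>
        f (fadd \<xi> v w) = fadd \<zeta> (f v) (f w)) \<and>
     (\<forall>c. \<forall>v\<in>topspace (total \<xi>). proj \<xi> v = x \<longrightarrow> f (fsmult \<xi> c v) = fsmult \<zeta> c (f v))"
  unfolding module_hom_class_ring by auto

text \<open>Preservation of zero is not part of \<open>module_hom\<close>; it follows from
  homogeneity, zero being the scalar 0 times itself.\<close>

lemma module_hom_zero:
  assumes "vectorspace class_ring M" "vectorspace class_ring N" "f \<in> module_hom class_ring M N"
  shows "f \<zero>\<^bsub>M\<^esub> = \<zero>\<^bsub>N\<^esub>"
proof -
  interpret M: vectorspace class_ring M by fact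
  interpret N: vectorspace class_ring N by fact
  have f: "f \<in> carrier M \<rightarrow> carrier N" and s: "\<And>c v. v \<in> carrier M \<Longrightarrow> f (c \<odot>\<^bsub>M\<^esub> v) = c \<odot>\<^bsub>N\<^esub> f v"
    using assms(3) by (auto simp: module_hom_class_ring)
  have "f (\<zero>\<^bsub>class_ring\<^esub> \<odot>\<^bsub>M\<^esub> \<zero>\<^bsub>M\<^esub>) = \<zero>\<^bsub>class_ring\<^esub> \<odot>\<^bsub>N\<^esub> f \<zero>\<^bsub>M\<^esub>"
    using s by blast
  then show ?thesis
    using f M.smult_l_null[of "\<zero>\<^bsub>M\<^esub>"] N.smult_l_null[of "f \<zero>\<^bsub>M\<^esub>"] by (auto simp: Pi_iff)
qed

text \<open>Each axiom of \<open>N\<close> is the image under \<open>f\<close> of the same axiom of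
  \<open>M\<close>. Preservation of zero is a hypothesis here because \<open>module_hom_zero\<close>
  presupposes that the target is already a vector space.\<close>

lemma vectorspace_transport:
  fixes M :: "('k::field, 'a, 'x) module_scheme" and N :: "('k, 'b, 'y) module_scheme"
  assumes "vectorspace class_ring M" and bij: "bij_betw f (carrier M) (carrier N)"
    and hom: "f \<in> module_hom class_ring M N" and zero: "f \<zero>\<^bsub>M\<^esub> = \<zero>\<^bsub>N\<^esub>"
  shows "vectorspace class_ring N"
proof -
  interpret M: vectorspace class_ring M by fact
  have im: "carrier N = f ` carrier M" using bij by (auto simp: bij_betw_def)
  have add: "\<And>v w. \<lbrakk>v \<in> carrier M; w \<in> carrier M\<rbrakk> \<Longrightarrow> f v \<oplus>\<^bsub>N\<^esub> f w = f (v \<oplus>\<^bsub>M\<^esub> w)"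
    and smult: "\<And>c v. v \<in> carrier M \<Longrightarrow> c \<odot>\<^bsub>N\<^esub> f v = f (c \<odot>\<^bsub>M\<^esub> v)"
    using hom by (auto simp: module_hom_class_ring)
  have "abelian_group N"
  proof (rule abelian_groupI)
    show "\<exists>y\<in>carrier N. y \<oplus>\<^bsub>N\<^esub> x = \<zero>\<^bsub>N\<^esub>" if "x \<in> carrier N" for x
    proof -
      from that obtain v where v: "v \<in> carrier M" "x = f v" by (auto simp: im)
      have "f (\<ominus>\<^bsub>M\<^esub> v) \<oplus>\<^bsub>N\<^esub> x = \<zero>\<^bsub>N\<^esub>" using v by (simp add: add M.M.l_neg zero)
      then show ?thesis using v im by blast
    qed
    show "\<zero>\<^bsub>N\<^esub> \<in> carrier N" using zero im by (metis M.M.zero_closed imageI)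
    show "\<And>x. x \<in> carrier N \<Longrightarrow> \<zero>\<^bsub>N\<^esub> \<oplus>\<^bsub>N\<^esub> x = x"
      unfolding zero[symmetric] by (auto simp: im add)
  qed (auto simp: im add M.M.a_ac)
  then interpret N: abelian_group N .
  have "Module.module class_ring N"
  proof (intro module.intro module.axioms(1)[OF vectorspace.axioms(1)[OF assms(1)]] N.abelian_group_axioms module_axioms.intro)
    fix a b :: 'k and x y assume "x \<in> carrier N" "y \<in> carrier N"
    then obtain v w where v: "v \<in> carrier M" "x = f v" and w: "w \<in> carrier M" "y = f w"
      by (auto simp: im)
    show "a \<odot>\<^bsub>N\<^esub> x \<in> carrier N"
      using v smult im by auto
    show "(a \<oplus>\<^bsub>class_ring\<^esub> b) \<odot>\<^bsub>N\<^esub> x = a \<odot>\<^bsub>N\<^esub> x \<oplus>\<^bsub>N\<^esub> b \<odot>\<^bsub>N\<^esub> x"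
      using v M.smult_l_distr[of a b v] smult[of v] add by simp
    show "a \<odot>\<^bsub>N\<^esub> (x \<oplus>\<^bsub>N\<^esub> y) = a \<odot>\<^bsub>N\<^esub> x \<oplus>\<^bsub>N\<^esub> a \<odot>\<^bsub>N\<^esub> y"
      using v w M.smult_r_distr[of a v w] smult add by simp
    show "(a \<otimes>\<^bsub>class_ring\<^esub> b) \<odot>\<^bsub>N\<^esub> x = a \<odot>\<^bsub>N\<^esub> (b \<odot>\<^bsub>N\<^esub> x)"
      using v M.smult_assoc1[of a b v] smult by simp
    show "\<one>\<^bsub>class_ring\<^esub> \<odot>\<^bsub>N\<^esub> x = x"
      using v M.smult_one[of v] smult by simp
  qed
  then show ?thesis
    using vectorspace.axioms(2)[OF assms(1)] by (simp add: vectorspace_def)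
qed

text \<open>\<open>group_action\<close> is a homomorphism into \<open>BijGroup\<close>; this unfolds
  it into pointwise laws. Extensionality stays in the list because the elements of
  \<open>BijGroup\<close> are extensional functions.\<close>

lemma G_space_iff:
  "G_space G X \<phi> \<longleftrightarrow> group G \<and>
     (\<forall>g\<in>carrier G. \<phi> g \<in> extensional (topspace X) \<and> continuous_map X X (\<phi> g)) \<and>
     (\<forall>x\<in>topspace X. \<phi> \<one>\<^bsub>G\<^esub> x = x) \<and>
     (\<forall>g\<in>carrier G. \<forall>h\<in>carrier G. \<forall>x\<in>topspace X. \<phi> (g \<otimes>\<^bsub>G\<^esub> h) x = \<phi> g (\<phi> h x))"
  (is "?L \<longleftrightarrow> ?R")
proof
  assume L: ?L
  then interpret group_action G "topspace X" \<phi> by (simp add: G_space_def)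
  have "group G" using group_hom by (simp add: group_hom_def)
  moreover have "\<phi> \<one>\<^bsub>G\<^esub> x = x" if "x \<in> topspace X" for x
    using id_eq_one that by (metis restrict_apply')
  ultimately show ?R
    using L bij_prop0 by (auto simp: G_space_def Bij_def composition_rule)
next
  assume R: ?R
  then interpret group G by blast
  have into: "\<phi> g x \<in> topspace X" if "g \<in> carrier G" "x \<in> topspace X" for g x
    using R that by (auto simp: continuous_map_def)
  have inv: "\<phi> (inv\<^bsub>G\<^esub> g) (\<phi> g x) = x" "\<phi> g (\<phi> (inv\<^bsub>G\<^esub> g) x) = x" if "g \<in> carrier G" "x \<in> topspace X" for g x
    using R that by (metis inv_closed l_inv, metis inv_closed r_inv)
  have bij: "\<phi> g \<in> Bij (topspace X)" if "g \<in> carrier G" for g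
    unfolding Bij_def using that R into inv
    by (auto intro!: bij_betw_byWitness[where f' = "\<phi> (inv\<^bsub>G\<^esub> g)"])
  have "\<phi> \<in> hom G (BijGroup (topspace X))"
  proof (rule homI)
    fix g h assume gh: "g \<in> carrier G" "h \<in> carrier G"
    have "\<phi> (g \<otimes>\<^bsub>G\<^esub> h) \<in> extensional (topspace X)" using R gh by blast
    then have "\<phi> (g \<otimes>\<^bsub>G\<^esub> h) = compose (topspace X) (\<phi> g) (\<phi> h)"
      using R gh by (intro extensionalityI[where A = "topspace X"]) (auto simp: compose_def)
    then show "\<phi> (g \<otimes>\<^bsub>G\<^esub> h) = \<phi> g \<otimes>\<^bsub>BijGroup (topspace X)\<^esub> \<phi> h"
      using bij gh by (simp add: BijGroup_def)
  qed (use bij in \<open>auto simp: BijGroup_def\<close>)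
  then have "group_action G (topspace X) \<phi>"
    using group_BijGroup is_group by (simp add: group_action_def group_hom_def group_hom_axioms_def)
  then show ?L using R by (simp add: G_space_def)
qed

lemma G_spaceD:
  assumes "G_space G X \<phi>"
  shows "group G"
    and "g \<in> carrier G \<Longrightarrow> \<phi> g \<in> extensional (topspace X)"
    and "g \<in> carrier G \<Longrightarrow> continuous_map X X (\<phi> g)"
    and "x \<in> topspace X \<Longrightarrow> \<phi> \<one>\<^bsub>G\<^esub> x = x"
    and "\<lbrakk>g \<in> carrier G; h \<in> carrier G; x \<in> topspace X\<rbrakk> \<Longrightarrow> \<phi> (g \<otimes>\<^bsub>G\<^esub> h) x = \<phi> g (\<phi> h x)"
    and "\<lbrakk>g \<in> carrier G; x \<in> topspace X\<rbrakk> \<Longrightarrow> \<phi> g x \<in> topspace X"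
    and "\<lbrakk>g \<in> carrier G; x \<in> topspace X\<rbrakk> \<Longrightarrow> \<phi> (inv\<^bsub>G\<^esub> g) (\<phi> g x) = x"
    and "\<lbrakk>g \<in> carrier G; x \<in> topspace X\<rbrakk> \<Longrightarrow> \<phi> g (\<phi> (inv\<^bsub>G\<^esub> g) x) = x"
proof -
  note R = assms[unfolded G_space_iff]
  then interpret group G by blast
  show "group G" by (rule is_group)
  show "g \<in> carrier G \<Longrightarrow> \<phi> g \<in> extensional (topspace X)"
    and "g \<in> carrier G \<Longrightarrow> continuous_map X X (\<phi> g)"
    and "x \<in> topspace X \<Longrightarrow> \<phi> \<one>\<^bsub>G\<^esub> x = x"
    and "\<lbrakk>g \<in> carrier G; h \<in> carrier G; x \<in> topspace X\<rbrakk> \<Longrightarrow> \<phi> (g \<otimes>\<^bsub>G\<^esub> h) x = \<phi> g (\<phi> h x)"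
    using R by blast+
  show "\<lbrakk>g \<in> carrier G; x \<in> topspace X\<rbrakk> \<Longrightarrow> \<phi> g x \<in> topspace X"
    using R by (auto simp: continuous_map_def)
  show "\<lbrakk>g \<in> carrier G; x \<in> topspace X\<rbrakk> \<Longrightarrow> \<phi> (inv\<^bsub>G\<^esub> g) (\<phi> g x) = x"
    using R by (metis inv_closed l_inv)
  show "\<lbrakk>g \<in> carrier G; x \<in> topspace X\<rbrakk> \<Longrightarrow> \<phi> g (\<phi> (inv\<^bsub>G\<^esub> g) x) = x"
    using R by (metis inv_closed r_inv)
qed

lemma vector_bundleD:
  assumes "vector_bundle X \<xi>"
  shows "e \<in> topspace (total \<xi>) \<Longrightarrow> proj \<xi> e \<in> topspace X"
    and "x \<in> topspace X \<Longrightarrow> fzero \<xi> x \<in> topspace (total \<xi>)"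
    and "x \<in> topspace X \<Longrightarrow> proj \<xi> (fzero \<xi> x) = x"
    and "\<lbrakk>e \<in> topspace (total \<xi>); e' \<in> topspace (total \<xi>); proj \<xi> e' = proj \<xi> e\<rbrakk>
      \<Longrightarrow> fadd \<xi> e e' \<in> topspace (total \<xi>)"
    and "\<lbrakk>e \<in> topspace (total \<xi>); e' \<in> topspace (total \<xi>); proj \<xi> e' = proj \<xi> e\<rbrakk>
      \<Longrightarrow> proj \<xi> (fadd \<xi> e e') = proj \<xi> e"
    and "e \<in> topspace (total \<xi>) \<Longrightarrow> fsmult \<xi> c e \<in> topspace (total \<xi>)"
    and "e \<in> topspace (total \<xi>) \<Longrightarrow> proj \<xi> (fsmult \<xi> c e) = proj \<xi> e"
proof -
  show pr: "e \<in> topspace (total \<xi>) \<Longrightarrow> proj \<xi> e \<in> topspace X" for e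
    using assms by (auto simp: vector_bundle_def continuous_map_def)
  have V: "vectorspace class_ring (fibre \<xi> x)" if "x \<in> topspace X" for x
    using that assms by (auto simp: vector_bundle_def)
  then have ab: "abelian_group (fibre \<xi> x)" and mo: "Module.module class_ring (fibre \<xi> x)" if "x \<in> topspace X" for x
    using that by (auto simp: vectorspace_def Module.module_def)
  show "x \<in> topspace X \<Longrightarrow> fzero \<xi> x \<in> topspace (total \<xi>)" "x \<in> topspace X \<Longrightarrow> proj \<xi> (fzero \<xi> x) = x"
    using abelian_monoid.zero_closed[OF abelian_group.axioms(1)[OF ab], of x] by auto
  assume e: "e \<in> topspace (total \<xi>)"
  show "fsmult \<xi> c e \<in> topspace (total \<xi>)" "proj \<xi> (fsmult \<xi> c e) = proj \<xi> e"
    using module.smult_closed[OF mo[OF pr[OF e]], of c e] e by auto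
  assume e': "e' \<in> topspace (total \<xi>)" "proj \<xi> e' = proj \<xi> e"
  show "fadd \<xi> e e' \<in> topspace (total \<xi>)" "proj \<xi> (fadd \<xi> e e') = proj \<xi> e"
    using abelian_monoid.a_closed[OF abelian_group.axioms(1)[OF ab[OF pr[OF e]]], of e e'] e e' by auto
qed

lemma equivariant_bundleD:
  assumes "equivariant_bundle G X \<phi> \<xi>"
  shows "vector_bundle X \<xi>" and "G_space G (total \<xi>) (act \<xi>)"
    and "\<lbrakk>g \<in> carrier G; x \<in> topspace X\<rbrakk> \<Longrightarrow> act \<xi> g \<in> module_hom class_ring (fibre \<xi> x) (fibre \<xi> (\<phi> g x))"
    and "\<lbrakk>g \<in> carrier G; e \<in> topspace (total \<xi>)\<rbrakk> \<Longrightarrow> proj \<xi> (act \<xi> g e) = \<phi> g (proj \<xi> e)"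
    and "\<lbrakk>g \<in> carrier G; e \<in> topspace (total \<xi>)\<rbrakk> \<Longrightarrow> act \<xi> g e \<in> topspace (total \<xi>)"
    and "\<lbrakk>g \<in> carrier G; e \<in> topspace (total \<xi>); e' \<in> topspace (total \<xi>); proj \<xi> e' = proj \<xi> e\<rbrakk>
      \<Longrightarrow> act \<xi> g (fadd \<xi> e e') = fadd \<xi> (act \<xi> g e) (act \<xi> g e')"
    and "\<lbrakk>g \<in> carrier G; e \<in> topspace (total \<xi>)\<rbrakk> \<Longrightarrow> act \<xi> g (fsmult \<xi> c e) = fsmult \<xi> c (act \<xi> g e)"
    and "\<lbrakk>g \<in> carrier G; x \<in> topspace X; \<phi> g x \<in> topspace X\<rbrakk> \<Longrightarrow> act \<xi> g (fzero \<xi> x) = fzero \<xi> (\<phi> g x)"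
proof -
  show vb: "vector_bundle X \<xi>" and "G_space G (total \<xi>) (act \<xi>)"
    and hom: "\<And>g x. \<lbrakk>g \<in> carrier G; x \<in> topspace X\<rbrakk> \<Longrightarrow> act \<xi> g \<in> module_hom class_ring (fibre \<xi> x) (fibre \<xi> (\<phi> g x))"
    using assms by (auto simp: equivariant_bundle_def)
  show "act \<xi> g (fzero \<xi> x) = fzero \<xi> (\<phi> g x)" if "g \<in> carrier G" "x \<in> topspace X" "\<phi> g x \<in> topspace X"
    using module_hom_zero[OF _ _ hom[OF that(1,2)]] that vb by (auto simp: vector_bundle_def)
  show "\<lbrakk>g \<in> carrier G; e \<in> topspace (total \<xi>)\<rbrakk> \<Longrightarrow> proj \<xi> (act \<xi> g e) = \<phi> g (proj \<xi> e)"
    "\<lbrakk>g \<in> carrier G; e \<in> topspace (total \<xi>)\<rbrakk> \<Longrightarrow> act \<xi> g e \<in> topspace (total \<xi>)"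
    "\<lbrakk>g \<in> carrier G; e \<in> topspace (total \<xi>); e' \<in> topspace (total \<xi>); proj \<xi> e' = proj \<xi> e\<rbrakk>
      \<Longrightarrow> act \<xi> g (fadd \<xi> e e') = fadd \<xi> (act \<xi> g e) (act \<xi> g e')"
    "\<lbrakk>g \<in> carrier G; e \<in> topspace (total \<xi>)\<rbrakk> \<Longrightarrow> act \<xi> g (fsmult \<xi> c e) = fsmult \<xi> c (act \<xi> g e)"
    using hom[of g "proj \<xi> e"] vector_bundleD(1)[OF vb, of e] unfolding module_hom_fibre by auto
qed

section \<open>Morphisms of equivariant bundles and the category they form\<close>

lemma bundle_hom_iff:
  "f \<in> bundle_hom G X \<xi> \<zeta> \<longleftrightarrow> f \<in> extensional (topspace (total \<xi>)) \<and>
     continuous_map (total \<xi>) (total \<zeta>) f \<and>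
     (\<forall>x\<in>topspace X. f \<in> module_hom class_ring (fibre \<xi> x) (fibre \<zeta> x)) \<and>
     (\<forall>g\<in>carrier G. \<forall>e\<in>topspace (total \<xi>). f (act \<xi> g e) = act \<zeta> g (f e))"
  by (simp add: bundle_hom_def)

lemma bundle_homD:
  assumes "f \<in> bundle_hom G X \<xi> \<zeta>" and "vector_bundle X \<xi>"
  shows "f \<in> extensional (topspace (total \<xi>))" and "continuous_map (total \<xi>) (total \<zeta>) f"
    and "\<lbrakk>g \<in> carrier G; e \<in> topspace (total \<xi>)\<rbrakk> \<Longrightarrow> f (act \<xi> g e) = act \<zeta> g (f e)"
    and "e \<in> topspace (total \<xi>) \<Longrightarrow> f e \<in> topspace (total \<zeta>)"
    and "e \<in> topspace (total \<xi>) \<Longrightarrow> proj \<zeta> (f e) = proj \<xi> e"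
    and "\<lbrakk>e \<in> topspace (total \<xi>); e' \<in> topspace (total \<xi>); proj \<xi> e' = proj \<xi> e\<rbrakk>
      \<Longrightarrow> f (fadd \<xi> e e') = fadd \<zeta> (f e) (f e')"
    and "e \<in> topspace (total \<xi>) \<Longrightarrow> f (fsmult \<xi> c e) = fsmult \<zeta> c (f e)"
proof -
  show "f \<in> extensional (topspace (total \<xi>))" and "continuous_map (total \<xi>) (total \<zeta>) f"
    and "\<lbrakk>g \<in> carrier G; e \<in> topspace (total \<xi>)\<rbrakk> \<Longrightarrow> f (act \<xi> g e) = act \<zeta> g (f e)"
    using assms(1) by (auto simp: bundle_hom_iff)
  assume e: "e \<in> topspace (total \<xi>)"
  then have "f \<in> module_hom class_ring (fibre \<xi> (proj \<xi> e)) (fibre \<zeta> (proj \<xi> e))"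
    using assms(1) vector_bundleD(1)[OF assms(2)] by (auto simp: bundle_hom_iff)
  with e show "f e \<in> topspace (total \<zeta>)" and "proj \<zeta> (f e) = proj \<xi> e"
    and "\<lbrakk>e' \<in> topspace (total \<xi>); proj \<xi> e' = proj \<xi> e\<rbrakk> \<Longrightarrow> f (fadd \<xi> e e') = fadd \<zeta> (f e) (f e')"
    and "f (fsmult \<xi> c e) = fsmult \<zeta> c (f e)"
    unfolding module_hom_fibre by auto
qed

lemma bundle_cat_simps [simp]:
  "Obj (bundle_cat G X \<O>) = \<O>"
  "Hom (bundle_cat G X \<O>) = bundle_hom G X"
  "Ident (bundle_cat G X \<O>) \<xi> = (\<lambda>e\<in>topspace (total \<xi>). e)"
  "Comp (bundle_cat G X \<O>) \<xi> \<zeta> \<chi> g f = compose (topspace (total \<xi>)) g f"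
  by (simp_all add: bundle_cat_def)

text \<open>Morphisms are extensional, so a map given by a formula has to be cut down to the total
  space. Linearity and equivariance survive because the fibre operations and the action do not leave
  the total space.\<close>

lemma bundle_hom_restrictI:
  assumes "equivariant_bundle G X \<phi> \<xi>" "continuous_map (total \<xi>) (total \<zeta>) f"
    and "\<And>x. x \<in> topspace X \<Longrightarrow> f \<in> module_hom class_ring (fibre \<xi> x) (fibre \<zeta> x)"
    and "\<And>g e. \<lbrakk>g \<in> carrier G; e \<in> topspace (total \<xi>)\<rbrakk> \<Longrightarrow> f (act \<xi> g e) = act \<zeta> g (f e)"
  shows "restrict f (topspace (total \<xi>)) \<in> bundle_hom G X \<xi> \<zeta>"
proof -
  note E = equivariant_bundleD(5)[OF assms(1)] and V = vector_bundleD(4-)[OF equivariant_bundleD(1)[OF assms(1)]]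
  have "continuous_map (total \<xi>) (total \<zeta>) (restrict f (topspace (total \<xi>)))"
    using assms(2) by (rule continuous_map_eq) auto
  then show ?thesis
    using assms(3,4) E V unfolding bundle_hom_iff module_hom_fibre by auto
qed

lemma category_bundle_cat:
  assumes "\<And>\<xi>. \<xi> \<in> \<O> \<Longrightarrow> equivariant_bundle G X \<phi> \<xi>"
  shows "category (bundle_cat G X \<O>)"
proof -
  have into: "f e \<in> topspace (total \<zeta>)" if "f \<in> bundle_hom G X \<xi> \<zeta>" "e \<in> topspace (total \<xi>)" for f \<xi> \<zeta> e
    using that by (auto simp: bundle_hom_iff continuous_map_def)
  have ext: "f \<in> extensional (topspace (total \<xi>))" if "f \<in> bundle_hom G X \<xi> \<zeta>" for f \<xi> \<zeta>
    using that by (auto simp: bundle_hom_iff)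
  have "(\<lambda>e\<in>topspace (total \<xi>). e) \<in> bundle_hom G X \<xi> \<xi>" if "\<xi> \<in> \<O>" for \<xi>
    by (rule bundle_hom_restrictI[OF assms[OF that]]) (auto simp: module_hom_fibre)
  moreover have "compose (topspace (total \<xi>)) g f \<in> bundle_hom G X \<xi> \<chi>"
    if "\<xi> \<in> \<O>" "\<zeta> \<in> \<O>" "f \<in> bundle_hom G X \<xi> \<zeta>" "g \<in> bundle_hom G X \<zeta> \<chi>" for \<xi> \<zeta> \<chi> f g
  proof -
    note \<xi> = equivariant_bundleD(1)[OF assms[OF that(1)]] and \<zeta> = equivariant_bundleD(1)[OF assms[OF that(2)]]
    note f = bundle_homD[OF that(3) \<xi>] and g = bundle_homD[OF that(4) \<zeta>]
    have "restrict (\<lambda>e. g (f e)) (topspace (total \<xi>)) \<in> bundle_hom G X \<xi> \<chi>"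
      by (rule bundle_hom_restrictI[OF assms[OF that(1)]])
        (use f g continuous_map_compose[OF f(2) g(2)] in \<open>auto simp: module_hom_fibre o_def\<close>)
    then show ?thesis by (simp add: compose_def)
  qed
  ultimately show ?thesis
    unfolding category_def bundle_cat_simps
  proof (intro conjI ballI)
    fix \<xi> \<zeta> f assume "f \<in> bundle_hom G X \<xi> \<zeta>"
    then show "compose (topspace (total \<xi>)) f (\<lambda>e\<in>topspace (total \<xi>). e) = f"
      and "compose (topspace (total \<xi>)) (\<lambda>e\<in>topspace (total \<zeta>). e) f = f"
      using ext[of f \<xi> \<zeta>] into[of f \<xi> \<zeta>] by (auto simp: compose_def fun_eq_iff extensional_def)
  next
    fix \<xi> \<zeta> \<chi> f g h assume "f \<in> bundle_hom G X \<xi> \<zeta>"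
    then show "compose (topspace (total \<xi>)) h (compose (topspace (total \<xi>)) g f) =
        compose (topspace (total \<xi>)) (compose (topspace (total \<zeta>)) h g) f"
      by (auto simp: compose_def into intro!: restrict_ext)
  qed auto
qed

section \<open>Transport along isomorphisms\<close>

text \<open>Asymmetric on purpose: \<open>\<zeta>\<close> need not be known to be a bundle, so that
  the notion can serve to prove that it is one. Preservation of zero and extensionality of the
  action on \<open>\<zeta>\<close>, which would follow for bundles, are therefore demanded. The two
  total spaces may have different types.\<close>

definition equivariant_iso ::
  "('g, 'z) monoid_scheme \<Rightarrow> 'm topology \<Rightarrow> ('e, 'm, 'g) gbundle \<Rightarrow> ('f, 'm, 'g) gbundle \<Rightarrow> ('e \<Rightarrow> 'f) \<Rightarrow> bool" where
  "equivariant_iso G X \<xi> \<zeta> f \<longleftrightarrow> homeomorphic_map (total \<xi>) (total \<zeta>) f \<and>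
     (\<forall>x\<in>topspace X. f \<in> module_hom class_ring (fibre \<xi> x) (fibre \<zeta> x) \<and> f (fzero \<xi> x) = fzero \<zeta> x) \<and>
     (\<forall>g\<in>carrier G. act \<zeta> g \<in> extensional (topspace (total \<zeta>)) \<and>
       (\<forall>e\<in>topspace (total \<xi>). f (act \<xi> g e) = act \<zeta> g (f e)))"

lemma equivariant_isoD:
  assumes "equivariant_iso G X \<xi> \<zeta> f" and "vector_bundle X \<xi>"
  shows "homeomorphic_map (total \<xi>) (total \<zeta>) f"
    and "x \<in> topspace X \<Longrightarrow> f \<in> module_hom class_ring (fibre \<xi> x) (fibre \<zeta> x)"
    and "x \<in> topspace X \<Longrightarrow> f (fzero \<xi> x) = fzero \<zeta> x"
    and "g \<in> carrier G \<Longrightarrow> act \<zeta> g \<in> extensional (topspace (total \<zeta>))"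
    and "\<lbrakk>g \<in> carrier G; e \<in> topspace (total \<xi>)\<rbrakk> \<Longrightarrow> f (act \<xi> g e) = act \<zeta> g (f e)"
    and "f ` topspace (total \<xi>) = topspace (total \<zeta>)"
    and "inj_on f (topspace (total \<xi>))"
    and "e \<in> topspace (total \<xi>) \<Longrightarrow> f e \<in> topspace (total \<zeta>)"
    and "e \<in> topspace (total \<xi>) \<Longrightarrow> proj \<zeta> (f e) = proj \<xi> e"
    and "\<lbrakk>e \<in> topspace (total \<xi>); e' \<in> topspace (total \<xi>); proj \<xi> e' = proj \<xi> e\<rbrakk>
      \<Longrightarrow> f (fadd \<xi> e e') = fadd \<zeta> (f e) (f e')"
    and "e \<in> topspace (total \<xi>) \<Longrightarrow> f (fsmult \<xi> c e) = fsmult \<zeta> c (f e)"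
proof -
  show hf: "homeomorphic_map (total \<xi>) (total \<zeta>) f"
    and hom: "\<And>x. x \<in> topspace X \<Longrightarrow> f \<in> module_hom class_ring (fibre \<xi> x) (fibre \<zeta> x)"
    and "x \<in> topspace X \<Longrightarrow> f (fzero \<xi> x) = fzero \<zeta> x"
    and "g \<in> carrier G \<Longrightarrow> act \<zeta> g \<in> extensional (topspace (total \<zeta>))"
    and "\<lbrakk>g \<in> carrier G; e \<in> topspace (total \<xi>)\<rbrakk> \<Longrightarrow> f (act \<xi> g e) = act \<zeta> g (f e)"
    using assms(1) by (auto simp: equivariant_iso_def)
  show "f ` topspace (total \<xi>) = topspace (total \<zeta>)" "inj_on f (topspace (total \<xi>))"
    using hf by (auto dest: homeomorphic_imp_surjective_map homeomorphic_imp_injective_map)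
  assume e: "e \<in> topspace (total \<xi>)"
  with hom[of "proj \<xi> e"] vector_bundleD(1)[OF assms(2), of e]
  show "f e \<in> topspace (total \<zeta>)" and "proj \<zeta> (f e) = proj \<xi> e"
    and "\<lbrakk>e' \<in> topspace (total \<xi>); proj \<xi> e' = proj \<xi> e\<rbrakk> \<Longrightarrow> f (fadd \<xi> e e') = fadd \<zeta> (f e) (f e')"
    and "f (fsmult \<xi> c e) = fsmult \<zeta> c (f e)"
    unfolding module_hom_fibre by auto
qed

text \<open>Replaces the existentially given inverse by a definite term, which later statements can
  name.\<close>

lemma homeomorphic_map_inv_into:
  assumes "homeomorphic_map X Y f"
  shows "homeomorphic_map Y X (inv_into (topspace X) f)"
proof -
  obtain h where h: "homeomorphic_maps X Y f h"
    using assms by (auto simp: homeomorphic_map_maps)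
  show ?thesis
  proof (rule homeomorphic_map_eq)
    show "homeomorphic_map Y X h"
      using h by (auto simp: homeomorphic_maps_map)
    show "h y = inv_into (topspace X) f y" if "y \<in> topspace Y" for y
      using h that homeomorphic_imp_injective_map[OF assms] unfolding homeomorphic_maps_def
      by (metis continuous_map_image_subset_topspace image_subset_iff inv_into_f_f)
  qed
qed

lemma trivialization_transport:
  assumes iso: "equivariant_iso G X \<xi> \<zeta> f" and vb: "vector_bundle X \<xi>"
    and U: "U \<subseteq> topspace X" and T: "trivialization n X \<xi> U \<Phi>"
  shows "trivialization n X \<zeta> U (\<Phi> \<circ> inv_into (topspace (total \<xi>)) f)"
proof -
  note I = equivariant_isoD[OF iso vb]
  let ?E = "topspace (total \<xi>)" and ?f' = "inv_into (topspace (total \<xi>)) f"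
  have f': "?f' e \<in> ?E" "f (?f' e) = e" if "e \<in> topspace (total \<zeta>)" for e
    using that I(6) by (auto intro: inv_into_into f_inv_into_f)
  have f'f: "?f' (f e) = e" if "e \<in> ?E" for e using that I(7) by simp
  have pf': "proj \<xi> (?f' e) = proj \<zeta> e" if "e \<in> topspace (total \<zeta>)" for e
    using I(9)[OF f'(1)[OF that]] f'(2)[OF that] by simp
  have "homeomorphic_map (total \<zeta>) (total \<xi>) ?f'"
    by (rule homeomorphic_map_inv_into[OF I(1)])
  moreover have "?f' ` (topspace (total \<zeta>) \<inter> {e \<in> topspace (total \<zeta>). proj \<zeta> e \<in> U}) =
      topspace (total \<xi>) \<inter> {e \<in> topspace (total \<xi>). proj \<xi> e \<in> U}"
    using f' f'f pf' I(8,9) by (force simp: image_iff)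
  ultimately have "homeomorphic_map (subtopology (total \<zeta>) {e \<in> topspace (total \<zeta>). proj \<zeta> e \<in> U})
      (subtopology (total \<xi>) {e \<in> topspace (total \<xi>). proj \<xi> e \<in> U}) ?f'"
    by (rule homeomorphic_map_subtopologies)
  moreover have "homeomorphic_map (subtopology (total \<xi>) {e \<in> topspace (total \<xi>). proj \<xi> e \<in> U})
      (prod_topology (subtopology X U) (coord_top n)) \<Phi>"
    and fst: "\<And>e. \<lbrakk>e \<in> ?E; proj \<xi> e \<in> U\<rbrakk> \<Longrightarrow> fst (\<Phi> e) = proj \<xi> e"
    and lin: "\<And>x. x \<in> U \<Longrightarrow> (\<lambda>e. snd (\<Phi> e)) \<in> module_hom class_ring (fibre \<xi> x) (coord_space n)"
    using T by (auto simp: trivialization_def)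
  ultimately have "homeomorphic_map (subtopology (total \<zeta>) {e \<in> topspace (total \<zeta>). proj \<zeta> e \<in> U})
      (prod_topology (subtopology X U) (coord_top n)) (\<Phi> \<circ> ?f')"
    by (blast intro: homeomorphic_map_compose)
  moreover have "fst ((\<Phi> \<circ> ?f') e) = proj \<zeta> e" if "e \<in> topspace (total \<zeta>)" "proj \<zeta> e \<in> U" for e
    using that f' pf' fst by simp
  moreover have "(\<lambda>e. snd ((\<Phi> \<circ> ?f') e)) \<in> module_hom class_ring (fibre \<zeta> x) (coord_space n)" if "x \<in> U" for x
  proof -
    have "?f' (fadd \<zeta> v w) = fadd \<xi> (?f' v) (?f' w)"
      if "v \<in> topspace (total \<zeta>)" "w \<in> topspace (total \<zeta>)" "proj \<zeta> v = x" "proj \<zeta> w = x" for v w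
      using that f' pf' I(10)[of "?f' v" "?f' w"] f'f vector_bundleD(4)[OF vb] by metis
    moreover have "?f' (fsmult \<zeta> c v) = fsmult \<xi> c (?f' v)" if "v \<in> topspace (total \<zeta>)" for v c
      using that f' pf' I(11)[of "?f' v"] f'f vector_bundleD(6)[OF vb] by metis
    ultimately show ?thesis
      using lin[OF that] f' pf' unfolding module_hom_class_ring by (auto simp: Pi_iff)
  qed
  ultimately show ?thesis by (simp add: trivialization_def)
qed

lemma equivariant_iso_sym:
  assumes iso: "equivariant_iso G X \<xi> \<zeta> f" and eb: "equivariant_bundle G X \<phi> \<xi>"
  shows "equivariant_iso G X \<zeta> \<xi> (inv_into (topspace (total \<xi>)) f)"
proof -
  note E = equivariant_bundleD[OF eb]
  note I = equivariant_isoD[OF iso E(1)]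
  let ?E = "topspace (total \<xi>)" and ?f' = "inv_into (topspace (total \<xi>)) f"
  have f': "?f' e \<in> ?E" "f (?f' e) = e" if "e \<in> topspace (total \<zeta>)" for e
    using that I(6) by (auto intro: inv_into_into f_inv_into_f)
  have f'f: "?f' (f e) = e" if "e \<in> ?E" for e using that I(7) by simp
  have pf': "proj \<xi> (?f' e) = proj \<zeta> e" if "e \<in> topspace (total \<zeta>)" for e
    using I(9)[OF f'(1)[OF that]] f'(2)[OF that] by simp
  have "homeomorphic_map (total \<zeta>) (total \<xi>) ?f'"
    by (rule homeomorphic_map_inv_into[OF I(1)])
  moreover have "?f' (fadd \<zeta> v w) = fadd \<xi> (?f' v) (?f' w)"
    if "v \<in> topspace (total \<zeta>)" "w \<in> topspace (total \<zeta>)" "proj \<zeta> w = proj \<zeta> v" for v w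
    using that f' pf' I(10)[of "?f' v" "?f' w"] f'f vector_bundleD(4)[OF E(1)] by metis
  moreover have "?f' (fsmult \<zeta> c v) = fsmult \<xi> c (?f' v)" if "v \<in> topspace (total \<zeta>)" for v c
    using that f' pf' I(11)[of "?f' v"] f'f vector_bundleD(6)[OF E(1)] by metis
  moreover have "?f' (fzero \<zeta> x) = fzero \<xi> x" if "x \<in> topspace X" for x
    using that I(3) f'f vector_bundleD(2)[OF E(1)] by metis
  moreover have "?f' (act \<zeta> g e) = act \<xi> g (?f' e)" if "g \<in> carrier G" "e \<in> topspace (total \<zeta>)" for g e
    using that I(5) f'f f' E(5) by metis
  ultimately show ?thesis
    using f' pf' G_spaceD(2)[OF E(2)] unfolding equivariant_iso_def module_hom_fibre by simp
qed

lemma equivariant_iso_trans: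
  assumes "equivariant_iso G X \<xi> \<zeta> f" "equivariant_iso G X \<zeta> \<chi> f'" "vector_bundle X \<xi>" "vector_bundle X \<zeta>"
  shows "equivariant_iso G X \<xi> \<chi> (f' \<circ> f)"
  using equivariant_isoD[OF assms(1,3)] equivariant_isoD[OF assms(2,4)]
  unfolding equivariant_iso_def module_hom_fibre
  by (auto intro: homeomorphic_map_compose)

lemma equivariant_iso_restrict_hom:
  assumes "equivariant_iso G X \<xi> \<zeta> f" "equivariant_bundle G X \<phi> \<xi>"
  shows "restrict f (topspace (total \<xi>)) \<in> bundle_hom G X \<xi> \<zeta>"
proof -
  note I = equivariant_isoD[OF assms(1) equivariant_bundleD(1)[OF assms(2)]]
  show ?thesis
    by (rule bundle_hom_restrictI[OF assms(2) homeomorphic_imp_continuous_map[OF I(1)] I(2,5)])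
qed

lemma equivariant_iso_cat_iso:
  assumes iso: "equivariant_iso G X \<xi> \<zeta> f"
    and "equivariant_bundle G X \<phi> \<xi>" "equivariant_bundle G X \<phi> \<zeta>"
  shows "cat_iso (bundle_cat G X \<O>) \<xi> \<zeta> (restrict f (topspace (total \<xi>)))"
proof -
  note I = equivariant_isoD[OF iso equivariant_bundleD(1)[OF assms(2)]]
  let ?f' = "inv_into (topspace (total \<xi>)) f"
  have "restrict ?f' (topspace (total \<zeta>)) \<in> bundle_hom G X \<zeta> \<xi>"
    by (rule equivariant_iso_restrict_hom[OF equivariant_iso_sym[OF iso assms(2)] assms(3)])
  moreover have "compose (topspace (total \<xi>)) (restrict ?f' (topspace (total \<zeta>))) (restrict f (topspace (total \<xi>)))
      = (\<lambda>e\<in>topspace (total \<xi>). e)"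
    "compose (topspace (total \<zeta>)) (restrict f (topspace (total \<xi>))) (restrict ?f' (topspace (total \<zeta>)))
      = (\<lambda>e\<in>topspace (total \<zeta>). e)"
    using I(6,7,8) by (auto simp: compose_def fun_eq_iff intro: inv_into_into f_inv_into_f)
  ultimately show ?thesis
    using equivariant_iso_restrict_hom[OF assms(1,2)] unfolding cat_iso_def by auto
qed

text \<open>Fibres, trivializations and action of \<open>\<zeta>\<close> are those of
  \<open>\<xi>\<close> conjugated by \<open>f\<close>. This is how a record that is merely
  isomorphic to a bundle is recognized as one.\<close>

lemma equivariant_bundle_transport:
  assumes iso: "equivariant_iso G X \<xi> \<zeta> f" and eb: "equivariant_bundle G X \<phi> \<xi>"
    and \<phi>: "\<And>g x. \<lbrakk>g \<in> carrier G; x \<in> topspace X\<rbrakk> \<Longrightarrow> \<phi> g x \<in> topspace X"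
  shows "equivariant_bundle G X \<phi> \<zeta>"
proof -
  note E = equivariant_bundleD[OF eb]
  note V = vector_bundleD[OF E(1)]
  note I = equivariant_isoD[OF iso E(1)]
  note A = G_spaceD[OF E(2)]
  let ?f' = "inv_into (topspace (total \<xi>)) f"
  note iso' = equivariant_iso_sym[OF iso eb]
  have homf': "homeomorphic_map (total \<zeta>) (total \<xi>) ?f'"
    using iso' by (simp add: equivariant_iso_def)
  then have cf': "continuous_map (total \<zeta>) (total \<xi>) ?f'"
    by (rule homeomorphic_imp_continuous_map)
  have f': "?f' e \<in> topspace (total \<xi>)" "f (?f' e) = e" if "e \<in> topspace (total \<zeta>)" for e
    using that I(6) by (auto intro: inv_into_into f_inv_into_f)
  have pf': "proj \<xi> (?f' e) = proj \<zeta> e" if "e \<in> topspace (total \<zeta>)" for e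
    using I(9)[OF f'(1)[OF that]] f'(2)[OF that] by simp
  have "continuous_map (total \<zeta>) X (proj \<zeta>)"
    by (rule continuous_map_eq[OF continuous_map_compose[OF cf']])
      (use E(1) pf' in \<open>auto simp: vector_bundle_def\<close>)
  moreover have "vectorspace class_ring (fibre \<zeta> x)" if x: "x \<in> topspace X" for x
  proof (rule vectorspace_transport)
    show "vectorspace class_ring (fibre \<xi> x)" using E(1) x by (simp add: vector_bundle_def)
    show "f \<in> module_hom class_ring (fibre \<xi> x) (fibre \<zeta> x)" using I(2) x .
    show "f \<zero>\<^bsub>fibre \<xi> x\<^esub> = \<zero>\<^bsub>fibre \<zeta> x\<^esub>" using I(3) x by simp
    show "bij_betw f (carrier (fibre \<xi> x)) (carrier (fibre \<zeta> x))"
      unfolding bij_betw_def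
    proof
      show "inj_on f (carrier (fibre \<xi> x))" using I(7) by (rule inj_on_subset) auto
      show "f ` carrier (fibre \<xi> x) = carrier (fibre \<zeta> x)"
        using I(8,9) f' pf' by (force simp: image_iff)
    qed
  qed
  moreover have "\<exists>n U \<Phi>. openin X U \<and> x \<in> U \<and> trivialization n X \<zeta> U \<Phi>" if x: "x \<in> topspace X" for x
  proof -
    obtain n U \<Phi> where U: "openin X U" "x \<in> U" and T: "trivialization n X \<xi> U \<Phi>"
      using E(1) x unfolding vector_bundle_def by blast
    show ?thesis
      by (intro exI conjI) (rule U trivialization_transport[OF iso E(1) openin_subset[OF U(1)] T])+
  qed
  ultimately have vb: "vector_bundle X \<zeta>" by (simp add: vector_bundle_def)
  have act\<zeta>: "act \<zeta> g e = f (act \<xi> g (?f' e))" if "g \<in> carrier G" "e \<in> topspace (total \<zeta>)" for g e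
    using that I(5) f' by metis
  have cont: "continuous_map (total \<zeta>) (total \<zeta>) (act \<zeta> g)" if g: "g \<in> carrier G" for g
    by (rule continuous_map_eq[OF continuous_map_compose[OF continuous_map_compose[OF cf' A(3)[OF g]]
            homeomorphic_imp_continuous_map[OF I(1)]]])
      (simp add: act\<zeta> g)
  have "G_space G (total \<zeta>) (act \<zeta>)"
    unfolding G_space_iff
  proof (intro conjI ballI)
    show "group G" by (rule A(1))
    fix e assume e: "e \<in> topspace (total \<zeta>)"
    have 1: "\<one>\<^bsub>G\<^esub> \<in> carrier G" using A(1) by (simp add: group.is_monoid)
    show "act \<zeta> \<one>\<^bsub>G\<^esub> e = e" using e f' A(4) act\<zeta>[OF 1] by simp
    fix g h assume gh: "g \<in> carrier G" "h \<in> carrier G"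
    then have "g \<otimes>\<^bsub>G\<^esub> h \<in> carrier G" using A(1) by (simp add: group.is_monoid monoid.m_closed)
    then show "act \<zeta> (g \<otimes>\<^bsub>G\<^esub> h) e = act \<zeta> g (act \<zeta> h e)"
      using gh e f' act\<zeta> A(5,6) I(7,8) by (simp add: inv_into_f_f)
  qed (use I(4) cont in auto)
  moreover have "act \<zeta> g \<in> module_hom class_ring (fibre \<zeta> x) (fibre \<zeta> (\<phi> g x))"
    if g: "g \<in> carrier G" and x: "x \<in> topspace X" for g x
  proof -
    note I' = equivariant_isoD[OF iso' vb]
    have "act \<zeta> g (fadd \<zeta> v w) = fadd \<zeta> (act \<zeta> g v) (act \<zeta> g w)"
      if "v \<in> topspace (total \<zeta>)" "w \<in> topspace (total \<zeta>)" "proj \<zeta> w = proj \<zeta> v" for v w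
      using that g act\<zeta> f' pf' I'(10) I(10) vector_bundleD(4)[OF vb] E(4,5,6) by simp
    moreover have "act \<zeta> g (fsmult \<zeta> c v) = fsmult \<zeta> c (act \<zeta> g v)"
      if "v \<in> topspace (total \<zeta>)" for v c
      using that g act\<zeta> f' pf' I'(11) I(11) vector_bundleD(6)[OF vb] E(4,5,7) by simp
    moreover have "act \<zeta> g v \<in> topspace (total \<zeta>)" "proj \<zeta> (act \<zeta> g v) = \<phi> g (proj \<zeta> v)"
      if "v \<in> topspace (total \<zeta>)" for v
      using that g f' pf' act\<zeta> E(4,5) I(8,9) by auto
    ultimately show ?thesis unfolding module_hom_fibre by auto
  qed
  ultimately show ?thesis using vb by (simp add: equivariant_bundle_def)
qed

section \<open>Invariance under isomorphism of the conditions on objects\<close>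

lemma fixed_only_in_zero_section_transport:
  assumes iso: "equivariant_iso G X \<xi> \<zeta> f" and eb: "equivariant_bundle G X \<phi> \<xi>"
    and zero_only: "fixed_only_in_zero_section \<xi> K" and K: "K \<subseteq> carrier G"
  shows "fixed_only_in_zero_section \<zeta> K"
  unfolding fixed_only_in_zero_section_def
proof
  note E = equivariant_bundleD[OF eb]
  note I = equivariant_isoD[OF iso E(1)]
  fix e assume "e \<in> fixed_points (topspace (total \<zeta>)) (act \<zeta>) K"
  then have e: "e \<in> topspace (total \<zeta>)" "\<And>k. k \<in> K \<Longrightarrow> act \<zeta> k e = e" by (auto simp: fixed_points_def)
  then obtain v where v: "v \<in> topspace (total \<xi>)" "e = f v" using I(6) by blast
  have "act \<xi> k v = v" if "k \<in> K" for k
    using that e v I(5)[of k v] I(7) E(5)[of k v] K by (metis inj_onD subsetD)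
  then have "v = fzero \<xi> (proj \<xi> v)"
    using zero_only v by (auto simp: fixed_only_in_zero_section_def fixed_points_def)
  then show "e = fzero \<zeta> (proj \<zeta> e)"
    using v I(3,9) vector_bundleD(1)[OF E(1)] by metis
qed

lemma equivariant_iso_sub_gbundle:
  assumes iso: "equivariant_iso G X \<xi> \<zeta> f" and vb: "vector_bundle X \<xi>"
    and S: "S \<subseteq> topspace (total \<xi>)" and stable: "\<And>g e. \<lbrakk>g \<in> carrier G; e \<in> S\<rbrakk> \<Longrightarrow> act \<xi> g e \<in> S"
  shows "equivariant_iso G X (sub_gbundle \<xi> S) (sub_gbundle \<zeta> (f ` S)) f"
proof -
  note I = equivariant_isoD[OF iso vb]
  have "homeomorphic_map (subtopology (total \<xi>) S) (subtopology (total \<zeta>) (f ` S)) f"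
    by (rule homeomorphic_map_subtopologies[OF I(1)]) (use S I(6) in auto)
  then show ?thesis
    using I S stable unfolding equivariant_iso_def module_hom_fibre
    by (auto simp: subset_iff restrict_action_def)
qed

text \<open>Carries the decomposition clause of \<open>has_type\<close>, which is a sum in a fibre,
  across an isomorphism.\<close>

lemma (in abelian_group) finsum_transport:
  fixes N (structure)
  assumes N: "abelian_group N" and fin: "finite I" and s: "s \<in> I \<rightarrow> carrier G"
    and f: "\<And>v. v \<in> carrier G \<Longrightarrow> f v \<in> carrier N" and f0: "f \<zero>\<^bsub>G\<^esub> = \<zero>\<^bsub>N\<^esub>"
    and fadd: "\<And>v w. \<lbrakk>v \<in> carrier G; w \<in> carrier G\<rbrakk> \<Longrightarrow> f (v \<oplus>\<^bsub>G\<^esub> w) = f v \<oplus>\<^bsub>N\<^esub> f w"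
  shows "f (finsum G s I) = finsum N (\<lambda>k. f (s k)) I"
  using fin s
proof (induction rule: finite_induct)
  case empty
  then show ?case using f0 N by (simp add: abelian_monoid.finsum_empty abelian_group.axioms)
next
  case (insert k I)
  interpret N: abelian_group N by fact
  have "finsum N (\<lambda>k. f (s k)) (insert k I) = f (s k) \<oplus>\<^bsub>N\<^esub> finsum N (\<lambda>k. f (s k)) I"
    by (rule N.finsum_insert) (use insert f in auto)
  then show ?case using insert fadd by (simp add: Pi_iff finsum_closed)
qed

text \<open>The subbundles are subsets of the total space and are replaced by their images under
  \<open>f\<close>. The bundles \<open>\<eta>\<close> are kept, and the isomorphisms onto the tensor
  products are precomposed with the inverse of \<open>f\<close>. Finiteness of the index set makes
  \<open>finsum\<close> a genuine sum, to which additivity of \<open>f\<close> applies.\<close>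

lemma has_type_transport:
  fixes \<xi> \<zeta> :: "('e, 'm, 'g) gbundle"
  assumes iso: "equivariant_iso N Y \<xi> \<zeta> f" and eb: "equivariant_bundle N Y \<psi> \<xi>"
    and \<psi>: "\<And>g x. \<lbrakk>g \<in> carrier N; x \<in> topspace Y\<rbrakk> \<Longrightarrow> \<psi> g x \<in> topspace Y"
    and H: "H \<subseteq> carrier N" and fin: "finite (irr_index \<rho>)" and ht: "has_type N Y \<psi> H \<rho> \<xi>"
  shows "has_type N Y \<psi> H \<rho> \<zeta>"
proof -
  note E = equivariant_bundleD[OF eb]
  note I = equivariant_isoD[OF iso E(1)]
  note eb' = equivariant_bundle_transport[OF iso eb \<psi>]
  note E' = equivariant_bundleD[OF eb']
  let ?f' = "inv_into (topspace (total \<xi>)) f" and ?I = "irr_index \<rho>"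
  have f': "?f' e \<in> topspace (total \<xi>)" "f (?f' e) = e" if "e \<in> topspace (total \<zeta>)" for e
    using that I(6) by (auto intro: inv_into_into f_inv_into_f)
  have pf': "proj \<xi> (?f' e) = proj \<zeta> e" if "e \<in> topspace (total \<zeta>)" for e
    using I(9)[OF f'(1)[OF that]] f'(2)[OF that] by simp
  obtain S where S: "\<And>k. k \<in> ?I \<Longrightarrow> S k \<subseteq> topspace (total \<xi>)"
    and ebS: "\<And>k. k \<in> ?I \<Longrightarrow> equivariant_bundle N Y \<psi> (sub_gbundle \<xi> (S k))"
    and \<eta>: "\<And>k. k \<in> ?I \<Longrightarrow> \<exists>\<eta> :: ('e, 'm) vbundle. vector_bundle_of_rank (mult_dim \<rho> k) Y \<eta> \<and>
                isomorphic_bundles (subgroup_of N H) Y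
                  (sub_gbundle \<xi> (S k)) (tensor_rep \<eta> (irr_dim \<rho> k) (irr \<rho> k))"
    and dec: "\<And>y e. \<lbrakk>y \<in> topspace Y; e \<in> carrier (fibre \<xi> y)\<rbrakk> \<Longrightarrow>
             \<exists>!s. s \<in> (\<Pi>\<^sub>E k\<in>?I. carrier (fibre (sub_gbundle \<xi> (S k)) y)) \<and> e = finsum (fibre \<xi> y) s ?I"
    using ht[unfolded has_type_def] by (elim exE conjE) metis
  \<comment> \<open>Invariance of \<open>S k\<close> is hidden in the bundle axioms of
    \<open>sub_gbundle\<close>: its action is a self-map of its total space.\<close>
  have stable: "act \<xi> g e \<in> S k" if "k \<in> ?I" "g \<in> carrier N" "e \<in> S k" for g e k
    using equivariant_bundleD(5)[OF ebS[OF that(1)] that(2), of e] that S by (auto simp: restrict_action_def)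
  have isoS: "equivariant_iso N Y (sub_gbundle \<xi> (S k)) (sub_gbundle \<zeta> (f ` S k)) f" if "k \<in> ?I" for k
    by (rule equivariant_iso_sub_gbundle[OF iso E(1)]) (use that S stable in auto)
  show ?thesis
    unfolding has_type_def
  proof (intro exI[of _ "\<lambda>k. f ` S k"] conjI ballI)
    fix k assume k: "k \<in> ?I"
    show "f ` S k \<subseteq> topspace (total \<zeta>)" using S[OF k] I(8) by blast
    show ebS': "equivariant_bundle N Y \<psi> (sub_gbundle \<zeta> (f ` S k))"
      by (rule equivariant_bundle_transport[OF isoS[OF k] ebS[OF k] \<psi>])
    define \<xi>k where "\<xi>k = sub_gbundle \<xi> (S k)"
    define \<zeta>k where "\<zeta>k = sub_gbundle \<zeta> (f ` S k)"
    define f'' where "f'' = inv_into (topspace (total \<xi>k)) f"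
    have iso': "equivariant_iso N Y \<zeta>k \<xi>k f''"
      unfolding \<xi>k_def \<zeta>k_def f''_def by (rule equivariant_iso_sym[OF isoS[OF k] ebS[OF k]])
    note J = equivariant_isoD[OF iso' equivariant_bundleD(1)[OF ebS', folded \<zeta>k_def]]
    obtain \<eta> :: "('e, 'm) vbundle" and h where "vector_bundle_of_rank (mult_dim \<rho> k) Y \<eta>"
      and h: "homeomorphic_map (total \<xi>k) (total (tensor_rep \<eta> (irr_dim \<rho> k) (irr \<rho> k))) h"
       "\<And>x. x \<in> topspace Y \<Longrightarrow> h \<in> module_hom class_ring (fibre \<xi>k x) (fibre (tensor_rep \<eta> (irr_dim \<rho> k) (irr \<rho> k)) x)"
       "\<And>g e. \<lbrakk>g \<in> H; e \<in> topspace (total \<xi>k)\<rbrakk> \<Longrightarrow> h (act \<xi>k g e) = act (tensor_rep \<eta> (irr_dim \<rho> k) (irr \<rho> k)) g (h e)"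
      using \<eta>[OF k] unfolding isomorphic_bundles_def \<xi>k_def by auto
    moreover have "isomorphic_bundles (subgroup_of N H) Y \<zeta>k (tensor_rep \<eta> (irr_dim \<rho> k) (irr \<rho> k))"
      unfolding isomorphic_bundles_def
    proof (intro exI[of _ "h \<circ> f''"] conjI ballI)
      show "homeomorphic_map (total \<zeta>k) (total (tensor_rep \<eta> (irr_dim \<rho> k) (irr \<rho> k))) (h \<circ> f'')"
        using J(1) h(1) by (rule homeomorphic_map_compose)
      show "h \<circ> f'' \<in> module_hom class_ring (fibre \<zeta>k x) (fibre (tensor_rep \<eta> (irr_dim \<rho> k) (irr \<rho> k)) x)"
        if "x \<in> topspace Y" for x
        using J(2)[OF that] h(2)[OF that] unfolding module_hom_class_ring by simp
      show "(h \<circ> f'') (act \<zeta>k g e) = act (tensor_rep \<eta> (irr_dim \<rho> k) (irr \<rho> k)) g ((h \<circ> f'') e)"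
        if "g \<in> carrier (subgroup_of N H)" "e \<in> topspace (total \<zeta>k)" for g e
        using that J(5,8) h(3) H by (auto simp: subset_iff)
    qed
    ultimately show "\<exists>\<eta> :: ('e, 'm) vbundle. vector_bundle_of_rank (mult_dim \<rho> k) Y \<eta> \<and>
                isomorphic_bundles (subgroup_of N H) Y
                  (sub_gbundle \<zeta> (f ` S k)) (tensor_rep \<eta> (irr_dim \<rho> k) (irr \<rho> k))"
      unfolding \<zeta>k_def by blast
  next
    fix y e assume y: "y \<in> topspace Y" and e: "e \<in> carrier (fibre \<zeta> y)"
    have v: "vectorspace class_ring (fibre \<xi> y)" "vectorspace class_ring (fibre \<zeta> y)"
      using E(1) E'(1) y by (auto simp: vector_bundle_def)
    have sum: "f (finsum (fibre \<xi> y) s ?I) = finsum (fibre \<zeta> y) (\<lambda>k. f (s k)) ?I"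
      if "s \<in> ?I \<rightarrow> carrier (fibre \<xi> y)" for s
      by (rule abelian_group.finsum_transport)
        (use v I(2,3)[OF y] that fin in \<open>auto simp: vectorspace_def Module.module_def module_hom_fibre\<close>)
    obtain s where s: "s \<in> (\<Pi>\<^sub>E k\<in>?I. carrier (fibre (sub_gbundle \<xi> (S k)) y))" "?f' e = finsum (fibre \<xi> y) s ?I"
      and uniq: "\<And>t. t \<in> (\<Pi>\<^sub>E k\<in>?I. carrier (fibre (sub_gbundle \<xi> (S k)) y)) \<Longrightarrow> ?f' e = finsum (fibre \<xi> y) t ?I \<Longrightarrow> t = s"
      using dec[OF y, of "?f' e"] f' pf' e by auto
    show "\<exists>!s. s \<in> (\<Pi>\<^sub>E k\<in>?I. carrier (fibre (sub_gbundle \<zeta> (f ` S k)) y)) \<and> e = finsum (fibre \<zeta> y) s ?I"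
    proof (rule ex1I[of _ "\<lambda>k\<in>?I. f (s k)"], intro conjI)
      show "(\<lambda>k\<in>?I. f (s k)) \<in> (\<Pi>\<^sub>E k\<in>?I. carrier (fibre (sub_gbundle \<zeta> (f ` S k)) y))"
        using s(1) I(8,9) by (auto simp: PiE_iff)
      have "e = f (finsum (fibre \<xi> y) s ?I)" using s(2)[symmetric] f'(2)[of e] e by simp
      also have "\<dots> = finsum (fibre \<zeta> y) (\<lambda>k. f (s k)) ?I"
        by (rule sum) (use s(1) in \<open>auto simp: PiE_iff\<close>)
      also have "\<dots> = finsum (fibre \<zeta> y) (\<lambda>k\<in>?I. f (s k)) ?I"
        by (rule abelian_monoid.finsum_cong')
          (use v s(1) I(8,9) in \<open>auto simp: vectorspace_def Module.module_def abelian_group_def PiE_iff\<close>)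
      finally show "e = finsum (fibre \<zeta> y) (\<lambda>k\<in>?I. f (s k)) ?I" .
    next
      fix t assume t: "t \<in> (\<Pi>\<^sub>E k\<in>?I. carrier (fibre (sub_gbundle \<zeta> (f ` S k)) y)) \<and> e = finsum (fibre \<zeta> y) t ?I"
      \<comment> \<open>Uniqueness is pulled back: the preimages of the components of
        \<open>t\<close> decompose \<open>?f' e\<close>, whose decomposition is unique.\<close>
      define t' where "t' = (\<lambda>k\<in>?I. ?f' (t k))"
      have tk: "t k \<in> topspace (total \<zeta>)" "t k \<in> f ` S k" "proj \<zeta> (t k) = y" if "k \<in> ?I" for k
        using t that by (auto simp: PiE_iff)
      have f'S: "?f' v \<in> S k" if "v \<in> f ` S k" "k \<in> ?I" for k v
        using that S I(7) by (auto simp: subset_iff)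
      have t': "t' \<in> (\<Pi>\<^sub>E k\<in>?I. carrier (fibre (sub_gbundle \<xi> (S k)) y))"
        unfolding t'_def using tk f'S f' pf' by (auto simp: PiE_iff)
      have "f (finsum (fibre \<xi> y) t' ?I) = finsum (fibre \<zeta> y) (\<lambda>k. f (t' k)) ?I"
        by (rule sum) (use t' in \<open>auto simp: PiE_iff\<close>)
      also have "\<dots> = finsum (fibre \<zeta> y) t ?I"
        by (rule abelian_monoid.finsum_cong')
          (use v tk f' in \<open>auto simp: vectorspace_def Module.module_def abelian_group_def t'_def\<close>)
      finally have "f (finsum (fibre \<xi> y) t' ?I) = e" using t by simp
      moreover have "finsum (fibre \<xi> y) t' ?I \<in> carrier (fibre \<xi> y)"
        by (rule abelian_monoid.finsum_closed)
          (use v t' in \<open>auto simp: vectorspace_def Module.module_def abelian_group_def PiE_iff\<close>)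
      ultimately have "?f' e = finsum (fibre \<xi> y) t' ?I" using I(7) by auto
      then have "s = t'" using uniq t' by blast
      show "t = (\<lambda>k\<in>?I. f (s k))"
        unfolding \<open>s = t'\<close> using t tk f' by (auto simp: t'_def PiE_iff extensional_def fun_eq_iff)
    qed
  qed
qed

section \<open>Restriction to a slice\<close>

text \<open>The extension of a morphism, the retraction and the induced action are all glued from
  open pieces on which fixed group elements serve as representatives.\<close>

lemma continuous_map_locally:
  assumes "\<And>x. x \<in> topspace X \<Longrightarrow> \<exists>U. openin X U \<and> x \<in> U \<and> continuous_map (subtopology X U) Y f"
  shows "continuous_map X Y f"
  unfolding continuous_map_def
proof (intro conjI allI impI)
  show "f \<in> topspace X \<rightarrow> topspace Y"
  proof
    fix x assume x: "x \<in> topspace X"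
    then obtain U where "openin X U" "x \<in> U" "continuous_map (subtopology X U) Y f" using assms by blast
    then show "f x \<in> topspace Y" using x by (auto simp: continuous_map_def Pi_iff)
  qed
  fix V assume V: "openin Y V"
  show "openin X {x \<in> topspace X. f x \<in> V}"
  proof (subst openin_subopen, intro ballI)
    fix x assume x: "x \<in> {x \<in> topspace X. f x \<in> V}"
    then obtain U where U: "openin X U" "x \<in> U" "continuous_map (subtopology X U) Y f" using assms by blast
    then have "openin (subtopology X U) {x \<in> topspace (subtopology X U). f x \<in> V}"
      using V by (auto simp: continuous_map_def)
    then have "openin X {x \<in> topspace (subtopology X U). f x \<in> V}"
      using U(1) openin_trans_full by blast
    then show "\<exists>T. openin X T \<and> x \<in> T \<and> T \<subseteq> {x \<in> topspace X. f x \<in> V}"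
      using x U(2) by (intro exI[of _ "{x \<in> topspace (subtopology X U). f x \<in> V}"]) auto
  qed
qed

text \<open>The input of the whole restriction and extension argument. \<open>stable\<close> and
  \<open>return\<close> say that the elements of \<open>G\<close> that move some point of
  \<open>F\<close> into \<open>F\<close> lie in \<open>N\<close>, and that \<open>N\<close>
  preserves \<open>F\<close>, so two translates of \<open>F\<close> coincide or are disjoint;
  \<open>cover\<close> says that the translates exhaust \<open>X\<close>.\<close>

locale open_slice =
  fixes G :: "('g, 'z) monoid_scheme" (structure)
    and X :: "'m topology" and \<phi> :: "'g \<Rightarrow> 'm \<Rightarrow> 'm" and N :: "'g set" and F :: "'m set"
  assumes G_space: "G_space G X \<phi>" and N: "subgroup N G" and openF: "openin X F"
    and cover: "x \<in> topspace X \<Longrightarrow> \<exists>g\<in>carrier G. \<phi> (inv g) x \<in> F"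
    and stable: "\<lbrakk>g \<in> N; x \<in> F\<rbrakk> \<Longrightarrow> \<phi> g x \<in> F"
    and return: "\<lbrakk>g \<in> carrier G; x \<in> F; \<phi> g x \<in> F\<rbrakk> \<Longrightarrow> g \<in> N"
begin

sublocale group G
  using G_spaceD(1)[OF G_space] .

abbreviation "GN \<equiv> subgroup_of G N"
abbreviation "Y \<equiv> subtopology X F"
abbreviation "\<psi> \<equiv> restrict_action \<phi> F"
abbreviation "res \<xi> \<equiv> restrict_to_base \<xi> F"

lemmas action = G_spaceD[OF G_space]

lemma N_carrier: "g \<in> N \<Longrightarrow> g \<in> carrier G"
  by (rule subgroup.mem_carrier[OF N])

lemma F_topspace: "x \<in> F \<Longrightarrow> x \<in> topspace X"
  by (rule subsetD[OF openin_subset[OF openF]])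

lemma topspace_Y: "topspace Y = F"
  using openin_subset[OF openF] by (simp add: Int_absorb1)

text \<open>The element carries one point of \<open>F\<close> to another, so \<open>return\<close>
  applies. This is what makes constructions independent of representatives.\<close>

lemma transition_in_N:
  assumes "x \<in> topspace X" "g \<in> carrier G" "h \<in> carrier G" "\<phi> (inv g) x \<in> F" "\<phi> (inv h) x \<in> F"
  shows "inv h \<otimes> g \<in> N"
proof (rule return[of _ "\<phi> (inv g) x"])
  have "\<phi> (inv h \<otimes> g) (\<phi> (inv g) x) = \<phi> (inv h) (\<phi> g (\<phi> (inv g) x))"
    using assms action(5,6) by simp
  then show "\<phi> (inv h \<otimes> g) (\<phi> (inv g) x) \<in> F" using assms action(8) by simp
  show "inv h \<otimes> g \<in> carrier G" using assms by blast
  show "\<phi> (inv g) x \<in> F" by (rule assms)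
qed

lemma res_bundle_hom:
  assumes \<xi>: "equivariant_bundle G X \<phi> \<xi>" and r\<xi>: "equivariant_bundle GN Y \<psi> (res \<xi>)"
    and f: "f \<in> bundle_hom G X \<xi> \<zeta>"
  shows "restrict f {e \<in> topspace (total \<xi>). proj \<xi> e \<in> F} \<in> bundle_hom GN Y (res \<xi>) (res \<zeta>)"
proof -
  note f' = bundle_homD[OF f equivariant_bundleD(1)[OF \<xi>]]
  note E = equivariant_bundleD[OF \<xi>]
  have "restrict f (topspace (total (res \<xi>))) \<in> bundle_hom GN Y (res \<xi>) (res \<zeta>)"
  proof (rule bundle_hom_restrictI[OF r\<xi>])
    show "continuous_map (total (res \<xi>)) (total (res \<zeta>)) f"
      using f'(2,4,5) by (auto simp: continuous_map_in_subtopology continuous_map_from_subtopology)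
    show "f \<in> module_hom class_ring (fibre (res \<xi>) x) (fibre (res \<zeta>) x)" if "x \<in> topspace Y" for x
      using that f'(4-) unfolding module_hom_fibre by auto
    show "f (act (res \<xi>) g e) = act (res \<zeta>) g (f e)"
      if "g \<in> carrier GN" "e \<in> topspace (total (res \<xi>))" for g e
      using that f'(3,4,5) N_carrier stable E(4,5) by (auto simp: restrict_action_def)
  qed
  then show ?thesis by (simp only: restrict_to_base_simps(1))
qed

lemma res_faithful:
  assumes \<xi>: "equivariant_bundle G X \<phi> \<xi>" and f: "f \<in> bundle_hom G X \<xi> \<zeta>" and f': "f' \<in> bundle_hom G X \<xi> \<zeta>"
    and eq: "restrict f {e \<in> topspace (total \<xi>). proj \<xi> e \<in> F} = restrict f' {e \<in> topspace (total \<xi>). proj \<xi> e \<in> F}"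
  shows "f = f'"
proof (rule extensionalityI)
  note E = equivariant_bundleD[OF \<xi>]
  note h = bundle_homD[OF f E(1)] and h' = bundle_homD[OF f' E(1)]
  show "f \<in> extensional (topspace (total \<xi>))" "f' \<in> extensional (topspace (total \<xi>))"
    using h(1) h'(1) .
  fix e assume e: "e \<in> topspace (total \<xi>)"
  then obtain g where g: "g \<in> carrier G" "\<phi> (inv g) (proj \<xi> e) \<in> F"
    using cover vector_bundleD(1)[OF E(1)] by blast
  let ?e = "act \<xi> (inv g) e"
  have e': "?e \<in> topspace (total \<xi>)" "proj \<xi> ?e \<in> F" "act \<xi> g ?e = e"
    using g e E(4,5) G_spaceD(8)[OF E(2)] by auto
  then have "f ?e = f' ?e" using eq by (metis (mono_tags, lifting) mem_Collect_eq restrict_apply')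
  then show "f e = f' e" using h(3) h'(3) g e' by metis
qed

lemma res_full:
  assumes \<xi>: "equivariant_bundle G X \<phi> \<xi>" and \<zeta>: "equivariant_bundle G X \<phi> \<zeta>"
    and r\<xi>: "equivariant_bundle GN Y \<psi> (res \<xi>)"
    and f: "f \<in> bundle_hom GN Y (res \<xi>) (res \<zeta>)"
  shows "\<exists>f'\<in>bundle_hom G X \<xi> \<zeta>. restrict f' {e \<in> topspace (total \<xi>). proj \<xi> e \<in> F} = f"
proof -
  note E = equivariant_bundleD[OF \<xi>] and Z = equivariant_bundleD[OF \<zeta>]
  note V = vector_bundleD[OF E(1)]
  note A = G_spaceD[OF E(2)] and B = G_spaceD[OF Z(2)]
  note h = bundle_homD[OF f equivariant_bundleD(1)[OF r\<xi>], simplified]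
  have hact: "f (act \<xi> n e) = act \<zeta> n (f e)"
    if "n \<in> N" "e \<in> topspace (total \<xi>)" "proj \<xi> e \<in> F" for n e
    using h(3)[of n e] h(4,5)[of e] that by (simp add: restrict_action_def)
  define k where "k e = (SOME g. g \<in> carrier G \<and> \<phi> (inv g) (proj \<xi> e) \<in> F)" for e
  define f' where "f' e = act \<zeta> (k e) (f (act \<xi> (inv (k e)) e))" for e
  have k: "k e \<in> carrier G" "\<phi> (inv (k e)) (proj \<xi> e) \<in> F" if "e \<in> topspace (total \<xi>)" for e
    using someI_ex[OF cover[OF V(1)[OF that], unfolded Bex_def]] unfolding k_def by auto
  \<comment> \<open>Independence of the representative: two of them differ by an element of
    \<open>N\<close>, with which \<open>f\<close> commutes. So one fixed \<open>g\<close> may be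
    used on a neighbourhood or on a whole fibre, although \<open>k\<close> is an arbitrary choice at
    each point.\<close>
  have f': "f' e = act \<zeta> g (f (act \<xi> (inv g) e))"
    if e: "e \<in> topspace (total \<xi>)" and g: "g \<in> carrier G" "\<phi> (inv g) (proj \<xi> e) \<in> F" for e g
  proof -
    let ?n = "inv (k e) \<otimes> g" and ?e = "act \<xi> (inv g) e"
    have n: "?n \<in> N" using transition_in_N V(1) e g k by blast
    have e': "?e \<in> topspace (total \<xi>)" "proj \<xi> ?e \<in> F" using e g E(4,5) by auto
    have "act \<xi> (inv (k e)) e = act \<xi> ?n ?e"
      using e g k e' A(5,8) by simp
    then have "f' e = act \<zeta> (k e) (act \<zeta> ?n (f ?e))"
      unfolding f'_def using hact[OF n e'] by simp
    also have "\<dots> = act \<zeta> (k e \<otimes> ?n) (f ?e)"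
      using B(5)[of "k e" ?n "f ?e"] h(4) e' k e g by simp
    also have "k e \<otimes> ?n = g"
      using k e g by (simp add: m_assoc[symmetric])
    finally show ?thesis .
  qed
  have "restrict f' (topspace (total \<xi>)) \<in> bundle_hom G X \<xi> \<zeta>"
  proof (rule bundle_hom_restrictI[OF \<xi>])
    show "continuous_map (total \<xi>) (total \<zeta>) f'"
    proof (rule continuous_map_locally)
      fix e assume e: "e \<in> topspace (total \<xi>)"
      define g where "g = k e"
      have g: "g \<in> carrier G" "inv g \<in> carrier G" "\<phi> (inv g) (proj \<xi> e) \<in> F" using k e by (auto simp: g_def)
      define U where "U = {e \<in> topspace (total \<xi>). (\<phi> (inv g) \<circ> proj \<xi>) e \<in> F}"
      have "continuous_map (total \<xi>) X (\<phi> (inv g) \<circ> proj \<xi>)"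
        using E(1) action(3)[OF g(2)] by (auto simp: vector_bundle_def intro: continuous_map_compose)
      then have "openin (total \<xi>) U"
        unfolding U_def using openF openin_continuous_map_preimage by blast
      moreover have "continuous_map (subtopology (total \<xi>) U) (total \<zeta>) f'"
      proof (rule continuous_map_eq)
        have "continuous_map (subtopology (total \<xi>) U) (total (res \<xi>)) (act \<xi> (inv g))"
          using A(3)[OF g(2)] E(4,5) g(2)
          by (auto simp: U_def continuous_map_in_subtopology continuous_map_from_subtopology)
        moreover have "continuous_map (total (res \<xi>)) (total \<zeta>) f"
          using h(2) by (simp add: continuous_map_in_subtopology)
        ultimately show "continuous_map (subtopology (total \<xi>) U) (total \<zeta>) (act \<zeta> g \<circ> (f \<circ> act \<xi> (inv g)))"
          using B(3)[OF g(1)] by (intro continuous_map_compose)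
        show "(act \<zeta> g \<circ> (f \<circ> act \<xi> (inv g))) e = f' e" if "e \<in> topspace (subtopology (total \<xi>) U)" for e
          using that f'[of e g] g(1) by (simp add: U_def)
      qed
      ultimately show "\<exists>U. openin (total \<xi>) U \<and> e \<in> U \<and> continuous_map (subtopology (total \<xi>) U) (total \<zeta>) f'"
        using e g by (intro exI[of _ U]) (auto simp: U_def)
    qed
    show "f' \<in> module_hom class_ring (fibre \<xi> x) (fibre \<zeta> x)" if x: "x \<in> topspace X" for x
    proof -
      obtain g where g: "g \<in> carrier G" "inv g \<in> carrier G" "\<phi> (inv g) x \<in> F" using cover x by blast
      have y: "\<phi> (inv g) x \<in> topspace X" "\<phi> g (\<phi> (inv g) x) = x" using g x action(6,8) by auto
      \<comment> \<open>Over \<open>x\<close> the extension is a composite of three linear maps,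
        through the fibres of both bundles over \<open>\<phi> (inv g) x\<close>.\<close>
      have "f \<in> module_hom class_ring (fibre \<xi> (\<phi> (inv g) x)) (fibre \<zeta> (\<phi> (inv g) x))"
        using h(4-) g(3) unfolding module_hom_fibre by auto
      with E(3)[OF g(2) x] Z(3)[OF g(1) y(1)] have
        "(\<lambda>e. act \<zeta> g (f (act \<xi> (inv g) e))) \<in> module_hom class_ring (fibre \<xi> x) (fibre \<zeta> x)"
        unfolding y(2) module_hom_class_ring by auto
      moreover have "f' e = act \<zeta> g (f (act \<xi> (inv g) e))" if "e \<in> topspace (total \<xi>)" "proj \<xi> e = x" for e
        using f'[of e g] that g by simp
      ultimately show ?thesis using V(4,5,6,7) unfolding module_hom_fibre by simp
    qed
    show "f' (act \<xi> a e) = act \<zeta> a (f' e)" if a: "a \<in> carrier G" and e: "e \<in> topspace (total \<xi>)" for a e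
    proof -
      \<comment> \<open>\<open>a \<otimes> k e\<close> need not be the representative chosen for the
        translated point, but it is admissible, and it brings that point back to the same point over
        \<open>F\<close>.\<close>
      have "inv (a \<otimes> k e) = inv (k e) \<otimes> inv a" using a k e inv_mult_group by blast
      then have "act \<xi> (inv (a \<otimes> k e)) (act \<xi> a e) = act \<xi> (inv (k e)) e"
        and "\<phi> (inv (a \<otimes> k e)) (proj \<xi> (act \<xi> a e)) = \<phi> (inv (k e)) (proj \<xi> e)"
        using a e k(1) E(4,5) A(5,7) action(5,6,7) V(1) by simp_all
      then have "f' (act \<xi> a e) = act \<zeta> (a \<otimes> k e) (f (act \<xi> (inv (k e)) e))"
        using f'[of "act \<xi> a e" "a \<otimes> k e"] a e k E(5) by simp
      then show ?thesis
        using B(5)[of a "k e" "f (act \<xi> (inv (k e)) e)"] h(4) E(4,5) k a e by (simp add: f'_def)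
    qed
  qed
  moreover have "restrict (restrict f' (topspace (total \<xi>))) {e \<in> topspace (total \<xi>). proj \<xi> e \<in> F} = f"
  proof (rule extensionalityI[OF restrict_extensional])
    show "f \<in> extensional {e \<in> topspace (total \<xi>). proj \<xi> e \<in> F}"
      using f by (simp only: bundle_hom_iff restrict_to_base_simps(1))
    fix e assume "e \<in> {e \<in> topspace (total \<xi>). proj \<xi> e \<in> F}"
    \<comment> \<open>Over \<open>F\<close> the unit is an admissible representative.\<close>
    then show "restrict (restrict f' (topspace (total \<xi>))) {e \<in> topspace (total \<xi>). proj \<xi> e \<in> F} e = f e"
      using f'[of e \<one>] h(4) A(4) B(4) action(4) F_topspace by simp
  qed
  ultimately show ?thesis by blast
qed

end

section \<open>The induced bundle\<close>

context open_slice
begin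

text \<open>For \<open>g\<close> in the group this is the translate of \<open>F\<close> by
  \<open>g\<close>, written as a preimage so that it is open by continuity of the action.\<close>

definition piece :: "'g \<Rightarrow> 'm set" where
  "piece g = {x \<in> topspace X. \<phi> (inv g) x \<in> F}"

text \<open>\<open>rep\<close> chooses one representative of each class modulo \<open>N\<close>: the condition defining \<open>rep x\<close> is the
  same for all \<open>x\<close> in a piece, so \<open>rep\<close> is locally constant. The value \<open>\<one>\<close> on \<open>F\<close> makes \<open>retract\<close> a
  retraction.\<close>

definition rep :: "'m \<Rightarrow> 'g" where
  "rep x = (if x \<in> F then \<one> else (SOME g. g \<in> carrier G \<and> x \<in> piece g))"

definition retract :: "'m \<Rightarrow> 'm" where
  "retract x = \<phi> (inv (rep x)) x"

text \<open>Measures how far the representatives are from being equivariant: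
  \<open>g \<otimes> rep x = rep (\<phi> g x) \<otimes> cocycle g x\<close>.\<close>

definition cocycle :: "'g \<Rightarrow> 'm \<Rightarrow> 'g" where
  "cocycle g x = inv (rep (\<phi> g x)) \<otimes> (g \<otimes> rep x)"

lemma open_piece:
  assumes "g \<in> carrier G"
  shows "openin X (piece g)"
  unfolding piece_def using action(3)[OF inv_closed[OF assms]] openF
  by (rule openin_continuous_map_preimage)

lemma piece_one: "x \<in> piece \<one> \<longleftrightarrow> x \<in> F"
  using F_topspace action(4) by (auto simp: piece_def)

lemma rep:
  assumes "x \<in> topspace X"
  shows "rep x \<in> carrier G" "x \<in> piece (rep x)"
proof -
  have "\<exists>g. g \<in> carrier G \<and> x \<in> piece g"
    using cover[OF assms] assms by (auto simp: piece_def)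
  from someI_ex[OF this] show "rep x \<in> carrier G" "x \<in> piece (rep x)"
    by (auto simp: rep_def piece_one)
qed

lemma rep_F: "x \<in> F \<Longrightarrow> rep x = \<one>"
  by (simp add: rep_def)

text \<open>The transition element at the common point lies in \<open>N\<close>, and
  \<open>N\<close> preserves all of \<open>F\<close>, so it serves for the whole translate. By
  symmetry, translates that meet are equal.\<close>

lemma piece_subset_piece:
  assumes g: "g \<in> carrier G" and h: "h \<in> carrier G" and x: "x \<in> piece g" "x \<in> piece h"
  shows "piece g \<subseteq> piece h"
proof
  fix y assume y: "y \<in> piece g"
  have n: "inv h \<otimes> g \<in> N" using x g h transition_in_N[of x g h] by (auto simp: piece_def)
  have "\<phi> (inv h \<otimes> g) (\<phi> (inv g) y) = \<phi> (inv h) y"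
    using y g h action(5,6,8) by (simp add: piece_def)
  then have "\<phi> (inv h) y \<in> F" using stable[OF n, of "\<phi> (inv g) y"] y by (simp add: piece_def)
  then show "y \<in> piece h" using y by (simp add: piece_def)
qed

lemma rep_cong:
  assumes g: "g \<in> carrier G" and x: "x \<in> piece g" "y \<in> piece g"
  shows "rep x = rep y"
proof -
  have "x \<in> piece h \<longleftrightarrow> y \<in> piece h" if "h \<in> carrier G" for h
    using piece_subset_piece[OF g that] x by blast
  then have "(h \<in> carrier G \<and> x \<in> piece h) = (h \<in> carrier G \<and> y \<in> piece h)" for h
    by blast
  moreover from this[of \<one>] have "x \<in> F \<longleftrightarrow> y \<in> F" by (simp add: piece_one)
  ultimately show ?thesis by (simp add: rep_def)
qed

lemma rep_piece_rep: "\<lbrakk>x \<in> topspace X; y \<in> piece (rep x)\<rbrakk> \<Longrightarrow> rep y = rep x"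
  using rep rep_cong by blast

lemma retract_in_F: "x \<in> topspace X \<Longrightarrow> retract x \<in> F"
  using rep(2) by (simp add: retract_def piece_def)

lemma retract_F: "x \<in> F \<Longrightarrow> retract x = x"
  using F_topspace action(4) by (simp add: retract_def rep_F)

lemma rep_retract: "x \<in> topspace X \<Longrightarrow> \<phi> (rep x) (retract x) = x"
  using rep(1) action(8) by (simp add: retract_def)

text \<open>The cocycle corrects the failure of \<open>retract\<close> to be equivariant. As it
  moves a point of \<open>F\<close> to a point of \<open>F\<close>, \<open>return\<close> puts it
  into \<open>N\<close>, where \<open>act \<zeta>\<close> is available.\<close>

lemma cocycle_retract:
  assumes g: "g \<in> carrier G" and x: "x \<in> topspace X"
  shows "cocycle g x \<in> N" "\<phi> (cocycle g x) (retract x) = retract (\<phi> g x)"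
proof -
  have r: "retract x \<in> topspace X" "rep x \<in> carrier G" "\<phi> g x \<in> topspace X" "rep (\<phi> g x) \<in> carrier G"
    using retract_in_F F_topspace rep g x action(6) by auto
  show *: "\<phi> (cocycle g x) (retract x) = retract (\<phi> g x)"
    using r g x action(5,6) rep_retract[OF x] by (simp add: cocycle_def retract_def[of "\<phi> g x"])
  show "cocycle g x \<in> N"
    by (rule return[of _ "retract x"]) (use r g x retract_in_F * in \<open>auto simp: cocycle_def\<close>)
qed

text \<open>The representative of the intermediate point cancels. This identity turns the twisted
  formula for \<open>act (induced \<zeta>)\<close> into an action.\<close>

lemma cocycle_mult:
  assumes "g \<in> carrier G" "h \<in> carrier G" "x \<in> topspace X"
  shows "cocycle (g \<otimes> h) x = cocycle g (\<phi> h x) \<otimes> cocycle h x"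
proof -
  have r: "rep x \<in> carrier G" "rep (\<phi> h x) \<in> carrier G" "rep (\<phi> g (\<phi> h x)) \<in> carrier G"
    using rep assms action(6) by auto
  have "rep (\<phi> h x) \<otimes> (inv (rep (\<phi> h x)) \<otimes> (h \<otimes> rep x)) = h \<otimes> rep x"
    using r assms by (simp add: m_assoc[symmetric])
  then show ?thesis
    using r assms action(5) by (simp add: cocycle_def m_assoc)
qed

lemma cocycle_one: "x \<in> topspace X \<Longrightarrow> cocycle \<one> x = \<one>"
  using rep(1) action(4) by (simp add: cocycle_def)

text \<open>The benefit of \<open>rep\<close> being \<open>\<one>\<close> on \<open>F\<close>: the
  induced bundle restricts to the given action of \<open>N\<close> and not to a twisted form of
  it.\<close>

lemma cocycle_F: "\<lbrakk>g \<in> N; x \<in> F\<rbrakk> \<Longrightarrow> cocycle g x = g"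
  using stable N_carrier by (simp add: cocycle_def rep_F)

lemma continuous_retract: "continuous_map X X retract"
proof (rule continuous_map_locally)
  fix x assume x: "x \<in> topspace X"
  have "continuous_map (subtopology X (piece (rep x))) X retract"
  proof (rule continuous_map_eq)
    show "continuous_map (subtopology X (piece (rep x))) X (\<phi> (inv (rep x)))"
      using action(3) rep(1)[OF x] by (simp add: continuous_map_from_subtopology)
  qed (use rep_piece_rep[OF x] in \<open>auto simp: retract_def\<close>)
  then show "\<exists>U. openin X U \<and> x \<in> U \<and> continuous_map (subtopology X U) X retract"
    using rep[OF x] open_piece by blast
qed

text \<open>The pair \<open>(x, v)\<close> stands for the class of \<open>(rep x, v)\<close> in \<open>G \<times>\<^sub>N \<zeta>\<close>; multiplying by \<open>g\<close> and
  renormalizing the representative produces the cocycle.\<close>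

definition induced :: "('e, 'm, 'g) gbundle \<Rightarrow> ('m \<times> 'e, 'm, 'g) gbundle" where
  "induced \<zeta> =
     \<lparr>total = subtopology (prod_topology X (total \<zeta>)) {(x, v). proj \<zeta> v = retract x},
      proj = fst,
      fzero = (\<lambda>x. (x, fzero \<zeta> (retract x))),
      fadd = (\<lambda>p q. (fst p, fadd \<zeta> (snd p) (snd q))),
      fsmult = (\<lambda>c p. (fst p, fsmult \<zeta> c (snd p))),
      act = (\<lambda>g. \<lambda>(x, v)\<in>{(x, v). x \<in> topspace X \<and> v \<in> topspace (total \<zeta>) \<and> proj \<zeta> v = retract x}.
               (\<phi> g x, act \<zeta> (cocycle g x) v))\<rparr>"

lemma induced_simps [simp]:
  "proj (induced \<zeta>) = fst"
  "fzero (induced \<zeta>) x = (x, fzero \<zeta> (retract x))"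
  "fadd (induced \<zeta>) p q = (fst p, fadd \<zeta> (snd p) (snd q))"
  "fsmult (induced \<zeta>) c p = (fst p, fsmult \<zeta> c (snd p))"
  "topspace (total (induced \<zeta>)) = {(x, v). x \<in> topspace X \<and> v \<in> topspace (total \<zeta>) \<and> proj \<zeta> v = retract x}"
  by (auto simp: induced_def)

lemma induced_act:
  "\<lbrakk>x \<in> topspace X; v \<in> topspace (total \<zeta>); proj \<zeta> v = retract x\<rbrakk>
    \<Longrightarrow> act (induced \<zeta>) g (x, v) = (\<phi> g x, act \<zeta> (cocycle g x) v)"
  by (simp add: induced_def)

text \<open>The universal property of the pullback along \<open>retract\<close>.\<close>

lemma continuous_map_induced:
  "continuous_map Z (total (induced \<zeta>)) f \<longleftrightarrow>
     continuous_map Z X (fst \<circ> f) \<and> continuous_map Z (total \<zeta>) (snd \<circ> f) \<and>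
     (\<forall>z\<in>topspace Z. proj \<zeta> (snd (f z)) = retract (fst (f z)))"
  by (auto simp: induced_def continuous_map_in_subtopology continuous_map_pairwise case_prod_unfold image_subset_iff)

lemma continuous_fst_induced: "continuous_map (total (induced \<zeta>)) X fst"
  and continuous_snd_induced: "continuous_map (total (induced \<zeta>)) (total \<zeta>) snd"
  by (simp_all add: induced_def continuous_map_from_subtopology continuous_map_fst continuous_map_snd)

text \<open>\<open>W\<close> lies in one piece, on which \<open>retract\<close> is the single map
  \<open>\<phi> (inv (rep x))\<close>. The fibre over \<open>y\<close> is that of
  \<open>\<zeta>\<close> over \<open>retract y\<close>, so the fibre coordinate of
  \<open>\<Phi>\<close> is kept and its base point is replaced by \<open>y\<close>.\<close>

lemma induced_trivialization:
  assumes x: "x \<in> topspace X"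
    and U: "openin Y U" and T: "trivialization n Y \<zeta> U \<Phi>"
    and W: "W = {y \<in> topspace X. \<phi> (inv (rep x)) y \<in> U}"
  shows "trivialization n X (induced \<zeta>) W (\<lambda>(y, v). (y, snd (\<Phi> v)))"
proof -
  let ?g = "inv (rep x)"
  have UF: "U \<subseteq> F" using openin_subset[OF U] by simp
  have g: "?g \<in> carrier G" using rep(1)[OF x] by simp
  have rW: "retract y = \<phi> ?g y" "retract y \<in> U" "y \<in> topspace X" if "y \<in> W" for y
    using that UF rep_piece_rep[OF x, of y] by (auto simp: W piece_def retract_def)
  let ?P = "subtopology (total \<zeta>) {v \<in> topspace (total \<zeta>). proj \<zeta> v \<in> U}"
  let ?Q = "prod_topology (subtopology Y U) (coord_top n)"
  let ?A = "subtopology (total (induced \<zeta>)) {e \<in> topspace (total (induced \<zeta>)). proj (induced \<zeta>) e \<in> W}"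
  let ?B = "prod_topology (subtopology X W) (coord_top n)"
  let ?\<Psi> = "\<lambda>(y, v). (y, snd (\<Phi> v))"
  have YU: "subtopology Y U = subtopology X U"
    using UF by (simp add: subtopology_subtopology Int_absorb1)
  have "homeomorphic_map ?P ?Q \<Phi>"
    and fst\<Phi>: "\<And>v. \<lbrakk>v \<in> topspace (total \<zeta>); proj \<zeta> v \<in> U\<rbrakk> \<Longrightarrow> fst (\<Phi> v) = proj \<zeta> v"
    and lin: "\<And>y. y \<in> U \<Longrightarrow> (\<lambda>v. snd (\<Phi> v)) \<in> module_hom class_ring (fibre \<zeta> y) (coord_space n)"
    using T by (auto simp: trivialization_def)
  then obtain \<Phi>' where "homeomorphic_maps ?P ?Q \<Phi> \<Phi>'"
    by (auto simp: homeomorphic_map_maps)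
  then have c\<Phi>: "continuous_map ?P ?Q \<Phi>" and c\<Phi>': "continuous_map ?Q ?P \<Phi>'"
    and \<Phi>'\<Phi>: "\<And>v. v \<in> topspace ?P \<Longrightarrow> \<Phi>' (\<Phi> v) = v" and \<Phi>\<Phi>': "\<And>q. q \<in> topspace ?Q \<Longrightarrow> \<Phi> (\<Phi>' q) = q"
    by (auto simp: homeomorphic_maps_def)
  \<comment> \<open>The base point is retracted into \<open>U\<close> before \<open>\<Phi>'\<close>
    is applied; writing the retraction as \<open>\<phi> ?g\<close> makes it visibly
    continuous.\<close>
  define \<Psi>' where "\<Psi>' q = (fst q, \<Phi>' (\<phi> ?g (fst q), snd q))" for q
  have inQ: "(\<phi> ?g (fst q), snd q) \<in> topspace ?Q" if "q \<in> topspace ?B" for q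
    using that UF F_topspace unfolding W by auto
  have inP: "snd e \<in> topspace ?P" if "e \<in> topspace ?A" for e
    using that rW by auto
  have "homeomorphic_maps ?A ?B ?\<Psi> \<Psi>'"
    unfolding homeomorphic_maps_def
  proof (intro conjI ballI)
    have "continuous_map ?A ?P snd"
      using inP by (auto simp: continuous_map_in_subtopology continuous_map_from_subtopology continuous_snd_induced)
    then have "continuous_map ?A (coord_top n) (snd \<circ> (\<Phi> \<circ> snd))"
      using c\<Phi> continuous_map_snd by (intro continuous_map_compose)
    moreover have "continuous_map ?A (subtopology X W) fst"
      by (auto simp: continuous_map_in_subtopology continuous_map_from_subtopology continuous_fst_induced)
    ultimately show "continuous_map ?A ?B ?\<Psi>"
      by (simp add: continuous_map_pairwise o_def case_prod_unfold)
    have "continuous_map ?B ?Q (\<lambda>q. (\<phi> ?g (fst q), snd q))"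
    proof -
      have "continuous_map (subtopology X W) (subtopology X U) (\<phi> ?g)"
        using action(3)[OF g] by (auto simp: W continuous_map_in_subtopology continuous_map_from_subtopology)
      then have "continuous_map ?B (subtopology X U) (\<phi> ?g \<circ> fst)"
        by (rule continuous_map_compose[OF continuous_map_fst])
      then show ?thesis
        unfolding YU by (simp add: continuous_map_pairwise o_def continuous_map_snd)
    qed
    then have "continuous_map ?B ?P (\<Phi>' \<circ> (\<lambda>q. (\<phi> ?g (fst q), snd q)))"
      using c\<Phi>' by (rule continuous_map_compose)
    then have 1: "continuous_map ?B (total \<zeta>) (snd \<circ> \<Psi>')" 
      by (simp add: continuous_map_in_subtopology \<Psi>'_def o_def)
    have 2: "continuous_map ?B X (fst \<circ> \<Psi>')"
      using continuous_map_fst[of "subtopology X W" "coord_top n"]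
      by (simp add: continuous_map_in_subtopology \<Psi>'_def o_def)
    have 3: "proj \<zeta> (snd (\<Psi>' q)) = retract (fst (\<Psi>' q))" "fst (\<Psi>' q) \<in> W" if "q \<in> topspace ?B" for q
    proof -
      have p: "\<Phi>' (\<phi> ?g (fst q), snd q) \<in> topspace ?P"
        using c\<Phi>' inQ[OF that] by (auto simp: continuous_map_def)
      then show "proj \<zeta> (snd (\<Psi>' q)) = retract (fst (\<Psi>' q))"
        using fst\<Phi>[of "\<Phi>' (\<phi> ?g (fst q), snd q)"] p \<Phi>\<Phi>'[OF inQ[OF that]] that rW(1)[of "fst q"]
        by (auto simp: \<Psi>'_def)
      show "fst (\<Psi>' q) \<in> W" using that by (auto simp: \<Psi>'_def)
    qed
    have c: "continuous_map ?B (total (induced \<zeta>)) \<Psi>'"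
      using 1 2 3 by (simp add: continuous_map_induced)
    have "\<Psi>' q \<in> topspace (total (induced \<zeta>))" if "q \<in> topspace ?B" for q
      by (rule subsetD[OF continuous_map_image_subset_topspace[OF c] imageI[OF that]])
    with c show "continuous_map ?B ?A \<Psi>'"
      using 3(2) by (simp add: continuous_map_in_subtopology image_subset_iff del: induced_simps(5))
  next
    fix e assume e: "e \<in> topspace ?A"
    then have "snd e \<in> topspace ?P" "fst e \<in> W" "proj \<zeta> (snd e) = \<phi> ?g (fst e)" using inP[OF e] rW(1) by auto
    moreover from this have "fst (\<Phi> (snd e)) = \<phi> ?g (fst e)" using fst\<Phi> by simp
    ultimately show "\<Psi>' (?\<Psi> e) = e"
      using \<Phi>'\<Phi> by (simp add: \<Psi>'_def case_prod_unfold) (metis prod.collapse)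
  next
    fix q assume "q \<in> topspace ?B"
    then show "?\<Psi> (\<Psi>' q) = q" using \<Phi>\<Phi>'[OF inQ] by (simp add: \<Psi>'_def)
  qed
  then have "homeomorphic_map ?A ?B ?\<Psi>" by (rule homeomorphic_maps_imp_map)
  moreover have "(\<lambda>e. snd (?\<Psi> e)) \<in> module_hom class_ring (fibre (induced \<zeta>) y) (coord_space n)" if y: "y \<in> W" for y
    using lin[OF rW(2)[OF y]] rW(3)[OF y] unfolding module_hom_class_ring by auto
  ultimately show ?thesis by (auto simp: trivialization_def)
qed

lemma vector_bundle_induced:
  assumes vb: "vector_bundle Y \<zeta>"
  shows "vector_bundle X (induced \<zeta>)"
  unfolding vector_bundle_def
proof (intro conjI ballI)
  show "continuous_map (total (induced \<zeta>)) X (proj (induced \<zeta>))"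
    using continuous_fst_induced by simp
  fix x assume x: "x \<in> topspace X"
  have r: "retract x \<in> topspace Y" using retract_in_F[OF x] topspace_Y by simp
  show "vectorspace class_ring (fibre (induced \<zeta>) x)"
  proof (rule vectorspace_transport)
    show "vectorspace class_ring (fibre \<zeta> (retract x))"
      using vb r by (simp add: vector_bundle_def)
    show "bij_betw (Pair x) (carrier (fibre \<zeta> (retract x))) (carrier (fibre (induced \<zeta>) x))"
      using x by (auto simp: bij_betw_def inj_on_def)
    show "Pair x \<in> module_hom class_ring (fibre \<zeta> (retract x)) (fibre (induced \<zeta>) x)"
      using x unfolding module_hom_fibre by auto
  qed simp
  obtain n U \<Phi> where U: "openin Y U" "retract x \<in> U" and T: "trivialization n Y \<zeta> U \<Phi>"
    using vb r unfolding vector_bundle_def by blast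
  let ?W = "{y \<in> topspace X. \<phi> (inv (rep x)) y \<in> U}"
  have "openin X U" using U(1) openF openin_trans_full by blast
  then have "openin X ?W"
    using action(3)[OF inv_closed[OF rep(1)[OF x]]] openin_continuous_map_preimage by blast
  moreover have "x \<in> ?W" using x U(2) by (simp add: retract_def)
  ultimately show "\<exists>n W \<Psi>. openin X W \<and> x \<in> W \<and> trivialization n X (induced \<zeta>) W \<Psi>"
    using induced_trivialization[OF x U(1) T refl] by blast
qed

lemma equivariant_bundle_induced:
  assumes eb: "equivariant_bundle GN Y \<psi> \<zeta>"
  shows "equivariant_bundle G X \<phi> (induced \<zeta>)"
proof -
  note E = equivariant_bundleD[OF eb]
  note A = G_spaceD[OF E(2)]
  have pact: "proj \<zeta> (act \<zeta> n v) = \<phi> n (proj \<zeta> v)" "act \<zeta> n v \<in> topspace (total \<zeta>)"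
    if "n \<in> N" "v \<in> topspace (total \<zeta>)" for n v
    using E(4,5)[of n v] that vector_bundleD(1)[OF E(1), of v] by (auto simp: restrict_action_def)
  have into: "act \<zeta> (cocycle g x) v \<in> topspace (total \<zeta>)" "proj \<zeta> (act \<zeta> (cocycle g x) v) = retract (\<phi> g x)"
    if "g \<in> carrier G" "x \<in> topspace X" "v \<in> topspace (total \<zeta>)" "proj \<zeta> v = retract x" for g x v
    using that pact cocycle_retract by simp_all
  have cont: "continuous_map (total (induced \<zeta>)) (total (induced \<zeta>)) (act (induced \<zeta>) g)"
    if g: "g \<in> carrier G" for g
  proof (rule continuous_map_locally)
    fix e assume "e \<in> topspace (total (induced \<zeta>))"
    then obtain x v where e: "e = (x, v)" and x: "x \<in> topspace X" by auto
    have gx: "\<phi> g x \<in> topspace X" using action(6) g x by blast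
    \<comment> \<open>On \<open>W\<close> both \<open>rep y\<close> and
      \<open>rep (\<phi> g y)\<close> are constant, hence so is the cocycle, and the action acts on
      each of the two components by one fixed continuous map.\<close>
    define W where "W = {y \<in> topspace X. y \<in> piece (rep x) \<and> \<phi> g y \<in> piece (rep (\<phi> g x))}"
    define U where "U = {e \<in> topspace (total (induced \<zeta>)). fst e \<in> W}"
    have "openin X {y \<in> topspace X. \<phi> g y \<in> piece (rep (\<phi> g x))}"
      using action(3)[OF g] open_piece[OF rep(1)[OF gx]] by (rule openin_continuous_map_preimage)
    then have "openin X (piece (rep x) \<inter> {y \<in> topspace X. \<phi> g y \<in> piece (rep (\<phi> g x))})"
      using open_piece[OF rep(1)[OF x]] by blast
    also have "piece (rep x) \<inter> {y \<in> topspace X. \<phi> g y \<in> piece (rep (\<phi> g x))} = W"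
      by (auto simp: W_def)
    finally have "openin (total (induced \<zeta>)) U"
      unfolding U_def using continuous_fst_induced openin_continuous_map_preimage by blast
    moreover have "e \<in> U"
      using \<open>e \<in> topspace _\<close> x gx rep(2) by (auto simp: U_def W_def e)
    moreover have "continuous_map (subtopology (total (induced \<zeta>)) U) (total (induced \<zeta>)) (act (induced \<zeta>) g)"
    proof (rule continuous_map_eq)
      let ?f = "\<lambda>e. (\<phi> g (fst e), act \<zeta> (cocycle g x) (snd e))"
      have coc: "cocycle g y = cocycle g x" if "y \<in> W" for y
        using that rep_piece_rep[OF x, of y] rep_piece_rep[OF gx, of "\<phi> g y"] by (simp add: W_def cocycle_def)
      show eq: "?f e = act (induced \<zeta>) g e" if "e \<in> topspace (subtopology (total (induced \<zeta>)) U)" for e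
        using that coc by (auto simp: U_def induced_act)
      have "continuous_map (subtopology (total (induced \<zeta>)) U) X (\<phi> g \<circ> fst)"
        using action(3)[OF g] continuous_fst_induced
        by (intro continuous_map_compose continuous_map_from_subtopology)
      moreover have "continuous_map (total \<zeta>) (total \<zeta>) (act \<zeta> (cocycle g x))"
        using A(3) cocycle_retract(1)[OF g x] by simp
      then have "continuous_map (subtopology (total (induced \<zeta>)) U) (total \<zeta>) (act \<zeta> (cocycle g x) \<circ> snd)"
        using continuous_snd_induced
        by (intro continuous_map_compose[where X' = "total \<zeta>"] continuous_map_from_subtopology)
      moreover have "proj \<zeta> (act \<zeta> (cocycle g x) (snd e)) = retract (\<phi> g (fst e))"
        if "e \<in> topspace (subtopology (total (induced \<zeta>)) U)" for e
        using that into(2)[OF g, of "fst e" "snd e"] coc[of "fst e"] by (auto simp: U_def)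
      ultimately show "continuous_map (subtopology (total (induced \<zeta>)) U) (total (induced \<zeta>)) ?f"
        by (simp add: continuous_map_induced o_def)
    qed
    ultimately show "\<exists>U. openin (total (induced \<zeta>)) U \<and> e \<in> U \<and>
        continuous_map (subtopology (total (induced \<zeta>)) U) (total (induced \<zeta>)) (act (induced \<zeta>) g)"
      by blast
  qed
  have "G_space G (total (induced \<zeta>)) (act (induced \<zeta>))"
    unfolding G_space_iff
  proof (intro conjI ballI)
    show "group G" by (rule is_group)
    fix g assume g: "g \<in> carrier G"
    show "act (induced \<zeta>) g \<in> extensional (topspace (total (induced \<zeta>)))"
      by (simp add: induced_simps(5)) (simp add: induced_def)
    show "continuous_map (total (induced \<zeta>)) (total (induced \<zeta>)) (act (induced \<zeta>) g)"
      by (rule cont[OF g])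
  next
    fix e assume "e \<in> topspace (total (induced \<zeta>))"
    then obtain x v where e: "e = (x, v)" and x: "x \<in> topspace X" and v: "v \<in> topspace (total \<zeta>)" "proj \<zeta> v = retract x"
      by auto
    show "act (induced \<zeta>) \<one> e = e"
      using x v e action(4) A(4) by (simp add: induced_act cocycle_one)
    fix g h assume g: "g \<in> carrier G" and h: "h \<in> carrier G"
    show "act (induced \<zeta>) (g \<otimes> h) e = act (induced \<zeta>) g (act (induced \<zeta>) h e)"
      using x v e g h into action(5,6) cocycle_mult A(5)[of "cocycle g (\<phi> h x)" "cocycle h x" v] cocycle_retract(1)
      by (simp add: induced_act)
  qed
  moreover have "act (induced \<zeta>) g \<in> module_hom class_ring (fibre (induced \<zeta>) x) (fibre (induced \<zeta>) (\<phi> g x))"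
    if g: "g \<in> carrier G" and x: "x \<in> topspace X" for g x
    using into[OF g x] cocycle_retract(1)[OF g x] E(6,7)[of "cocycle g x"] vector_bundleD(4-)[OF E(1)] action(6)[OF g x] x
    unfolding module_hom_fibre by (auto simp: induced_act)
  ultimately show ?thesis
    using vector_bundle_induced[OF E(1)] by (simp add: equivariant_bundle_def)
qed

text \<open>Over \<open>F\<close> the retraction is the identity and the cocycle of \<open>g\<close>
  in \<open>N\<close> is \<open>g\<close>, so the pullback is the graph of
  \<open>proj \<zeta>\<close> with unchanged action.\<close>

lemma equivariant_iso_res_induced:
  assumes eb: "equivariant_bundle GN Y \<psi> \<zeta>"
  shows "equivariant_iso GN Y \<zeta> (res (induced \<zeta>)) (\<lambda>v. (proj \<zeta> v, v))"
proof -
  note E = equivariant_bundleD[OF eb] and V = vector_bundleD[OF equivariant_bundleD(1)[OF eb]]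
  have pF: "proj \<zeta> v \<in> F" "proj \<zeta> v \<in> topspace X" if "v \<in> topspace (total \<zeta>)" for v
    using V(1)[OF that] by auto
  have "continuous_map (total \<zeta>) X (proj \<zeta>)"
    using E(1) by (simp add: vector_bundle_def continuous_map_in_subtopology)
  then have "continuous_map (total \<zeta>) (total (induced \<zeta>)) (\<lambda>v. (proj \<zeta> v, v))"
    using pF retract_F by (simp add: continuous_map_induced o_def)
  then have "continuous_map (total \<zeta>) (total (res (induced \<zeta>))) (\<lambda>v. (proj \<zeta> v, v))"
    using pF retract_F by (auto simp: continuous_map_in_subtopology)
  moreover have "continuous_map (total (res (induced \<zeta>))) (total \<zeta>) snd"
    by (simp add: continuous_map_from_subtopology continuous_snd_induced)
  ultimately have "homeomorphic_maps (total \<zeta>) (total (res (induced \<zeta>))) (\<lambda>v. (proj \<zeta> v, v)) snd"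
    by (auto simp: homeomorphic_maps_def retract_F)
  then have "homeomorphic_map (total \<zeta>) (total (res (induced \<zeta>))) (\<lambda>v. (proj \<zeta> v, v))"
    by (rule homeomorphic_maps_imp_map)
  moreover have "(proj \<zeta> (act \<zeta> g v), act \<zeta> g v) = act (res (induced \<zeta>)) g (proj \<zeta> v, v)"
    if "g \<in> N" "v \<in> topspace (total \<zeta>)" for g v
    using that pF[of v] E(4)[of g v] by (simp add: restrict_action_def induced_act retract_F cocycle_F)
  ultimately show ?thesis
    using V pF unfolding equivariant_iso_def module_hom_fibre
    by (auto simp: retract_F restrict_action_def)
qed

end

section \<open>Realizing a bundle on a prescribed type of points\<close>

definition transported :: "('a \<Rightarrow> 'b) \<Rightarrow> ('a, 'm, 'g) gbundle \<Rightarrow> ('b, 'm, 'g) gbundle" where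
  "transported J \<xi> = (let E = topspace (total \<xi>); J' = inv_into E J in
     \<lparr>total = pullback_topology (J ` E) J' (total \<xi>), proj = (\<lambda>e. proj \<xi> (J' e)), fzero = (\<lambda>x. J (fzero \<xi> x)),
      fadd = (\<lambda>e e'. J (fadd \<xi> (J' e) (J' e'))), fsmult = (\<lambda>c e. J (fsmult \<xi> c (J' e))),
      act = (\<lambda>g. \<lambda>e\<in>J ` E. J (act \<xi> g (J' e)))\<rparr>)"

text \<open>Holds by construction: the topology is pulled back along the inverse of \<open>J\<close>
  and the operations are conjugated by \<open>J\<close>. Hence \<open>J\<close> may come from
  counting points, without regard to any topology.\<close>

lemma equivariant_iso_transported:
  assumes J: "inj_on J (topspace (total \<xi>))"
  shows "equivariant_iso G X \<xi> (transported J \<xi>) J"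
proof -
  let ?E = "topspace (total \<xi>)"
  have J': "inv_into ?E J (J e) = e" if "e \<in> ?E" for e using J that by simp
  have top: "topspace (total (transported J \<xi>)) = J ` ?E"
    using J' by (auto simp: transported_def Let_def topspace_pullback_topology)
  have "continuous_map (total \<xi>) (total (transported J \<xi>)) J"
    unfolding transported_def Let_def
    by (auto intro!: continuous_map_pullback' continuous_map_eq[OF continuous_map_id] simp: J')
  moreover have "continuous_map (total (transported J \<xi>)) (total \<xi>) (inv_into ?E J)"
    using continuous_map_pullback[OF continuous_map_id, where f = "inv_into ?E J" and A = "J ` ?E"]
    by (simp add: transported_def Let_def)
  ultimately have "homeomorphic_map (total \<xi>) (total (transported J \<xi>)) J"
    using J' top by (intro homeomorphic_maps_imp_map[where g = "inv_into ?E J"]) (auto simp: homeomorphic_maps_def)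
  then show ?thesis
    unfolding equivariant_iso_def module_hom_fibre top
    by (auto simp: transported_def Let_def J')
qed

text \<open>Induction on the dimension; one coordinate at a time is absorbed by an injection of
  \<open>complex \<times> complex\<close> into \<open>complex\<close>, which exists because
  \<open>complex\<close> is infinite.\<close>

lemma inj_complex_power: "\<exists>q :: (nat \<Rightarrow> complex) \<Rightarrow> complex. inj_on q ({..<n} \<rightarrow>\<^sub>E UNIV)"
proof (induction n)
  case 0
  then show ?case by simp
next
  case (Suc n)
  then obtain q :: "(nat \<Rightarrow> complex) \<Rightarrow> complex" where q: "inj_on q ({..<n} \<rightarrow>\<^sub>E UNIV)" by blast
  obtain p :: "complex \<times> complex \<Rightarrow> complex" where p: "inj p"
    using card_of_Times_same_infinite[OF infinite_UNIV_char_0[where 'a = complex]]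
    unfolding card_of_ordIso[symmetric] bij_betw_def UNIV_Times_UNIV by blast
  have "inj_on (\<lambda>f. p (q (restrict f {..<n}), f n)) ({..<Suc n} \<rightarrow>\<^sub>E UNIV)"
  proof (rule inj_onI)
    fix f g assume f: "f \<in> {..<Suc n} \<rightarrow>\<^sub>E UNIV" and g: "g \<in> {..<Suc n} \<rightarrow>\<^sub>E UNIV"
      and "p (q (restrict f {..<n}), f n) = p (q (restrict g {..<n}), g n)"
    then have n: "f n = g n" and "q (restrict f {..<n}) = q (restrict g {..<n})"
      using p by (auto dest: injD)
    then have r: "restrict f {..<n} = restrict g {..<n}"
      by (intro inj_onD[OF q]) auto
    show "f = g"
    proof (rule PiE_ext[OF f g])
      fix i assume "i \<in> {..<Suc n}"
      then show "f i = g i" using n r by (metis lessThan_iff less_Suc_eq restrict_apply')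
    qed
  qed
  then show ?case by blast
qed

text \<open>A bundle over \<open>X\<close> has at most as many points as \<open>X \<times> \<complex>\<close>, so the induced bundle fits into \<open>'e\<close>.\<close>

lemma inj_on_total_space:
  fixes \<xi> :: "('a, 'm, 'z) vbundle_scheme" and j :: "'m \<times> complex \<Rightarrow> 'e"
  assumes vb: "vector_bundle X \<xi>" and j: "inj j"
  shows "\<exists>J :: 'a \<Rightarrow> 'e. inj_on J (topspace (total \<xi>))"
proof -
  have "\<exists>q :: 'a \<Rightarrow> complex. inj_on q (carrier (fibre \<xi> x))" if x: "x \<in> topspace X" for x
  proof -
    obtain n U \<Phi> where U: "x \<in> U" and T: "trivialization n X \<xi> U \<Phi>"
      using vb x unfolding vector_bundle_def by blast
    obtain q :: "(nat \<Rightarrow> complex) \<Rightarrow> complex" where q: "inj_on q ({..<n} \<rightarrow>\<^sub>E UNIV)"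
      using inj_complex_power by blast
    have "inj_on \<Phi> (topspace (subtopology (total \<xi>) {e \<in> topspace (total \<xi>). proj \<xi> e \<in> U}))"
      using T unfolding trivialization_def by (blast dest: homeomorphic_imp_injective_map)
    then have \<Phi>: "inj_on \<Phi> (carrier (fibre \<xi> x))"
      by (rule inj_on_subset) (use U in auto)
    have fst: "fst (\<Phi> e) = x" if "e \<in> carrier (fibre \<xi> x)" for e
      using T U that by (auto simp: trivialization_def)
    have snd: "snd (\<Phi> e) \<in> {..<n} \<rightarrow>\<^sub>E UNIV" if "e \<in> carrier (fibre \<xi> x)" for e
      using T U that by (auto simp: trivialization_def module_hom_class_ring coord_space_def)
    have "inj_on (\<lambda>e. q (snd (\<Phi> e))) (carrier (fibre \<xi> x))"
    proof (rule inj_onI)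
      fix e e' assume e: "e \<in> carrier (fibre \<xi> x)" and e': "e' \<in> carrier (fibre \<xi> x)"
        and "q (snd (\<Phi> e)) = q (snd (\<Phi> e'))"
      then have "snd (\<Phi> e) = snd (\<Phi> e')" using inj_onD[OF q] snd by blast
      then have "\<Phi> e = \<Phi> e'" using fst[OF e] fst[OF e'] by (simp add: prod_eq_iff)
      then show "e = e'" using inj_onD[OF \<Phi>] e e' by blast
    qed
    then show ?thesis by blast
  qed
  then obtain q :: "'m \<Rightarrow> 'a \<Rightarrow> complex" where q: "\<And>x. x \<in> topspace X \<Longrightarrow> inj_on (q x) (carrier (fibre \<xi> x))"
    by metis
  have "inj_on (\<lambda>e. j (proj \<xi> e, q (proj \<xi> e) e)) (topspace (total \<xi>))"
  proof (rule inj_onI)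
    fix e e' assume e: "e \<in> topspace (total \<xi>)" and e': "e' \<in> topspace (total \<xi>)"
      and "j (proj \<xi> e, q (proj \<xi> e) e) = j (proj \<xi> e', q (proj \<xi> e') e')"
    then have "proj \<xi> e' = proj \<xi> e" "q (proj \<xi> e) e = q (proj \<xi> e) e'"
      using j by (auto dest: injD)
    then show "e = e'"
      using inj_onD[OF q[OF vector_bundleD(1)[OF vb e]], of e e'] e e' by simp
  qed
  then show ?thesis by blast
qed

context open_slice
begin

lemma equivariant_iso_res:
  assumes iso: "equivariant_iso G X \<xi> \<zeta> f" and eb: "equivariant_bundle G X \<phi> \<xi>"
  shows "equivariant_iso GN Y (res \<xi>) (res \<zeta>) f"
proof -
  note E = equivariant_bundleD[OF eb]
  note I = equivariant_isoD[OF iso E(1)]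
  have "homeomorphic_map (total (res \<xi>)) (total (res \<zeta>)) f"
    unfolding restrict_to_base_simps(2)
  proof (rule homeomorphic_map_subtopologies[OF I(1)])
    show "f ` (topspace (total \<xi>) \<inter> {e \<in> topspace (total \<xi>). proj \<xi> e \<in> F}) =
        topspace (total \<zeta>) \<inter> {e \<in> topspace (total \<zeta>). proj \<zeta> e \<in> F}"
      unfolding I(6)[symmetric] using I(9) by auto
  qed
  then show ?thesis
    using I(3,5,8,9,10,11) E(4,5) stable N_carrier unfolding equivariant_iso_def module_hom_fibre
    by (auto simp: restrict_action_def)
qed

text \<open>The isomorphism starts at \<open>\<zeta>\<close>, the bundle whose properties are known,
  so that they can be transported to the restriction of \<open>\<xi>\<close>.\<close>

lemma ex_extension:
  fixes \<zeta> :: "('e, 'm, 'g) gbundle" and j :: "'m \<times> complex \<Rightarrow> 'e"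
  assumes eb: "equivariant_bundle GN Y \<psi> \<zeta>" and j: "inj j"
  shows "\<exists>(\<xi> :: ('e, 'm, 'g) gbundle) f. equivariant_bundle G X \<phi> \<xi> \<and> equivariant_iso GN Y \<zeta> (res \<xi>) f"
proof -
  let ?\<xi> = "induced \<zeta>"
  have ind: "equivariant_bundle G X \<phi> ?\<xi>" by (rule equivariant_bundle_induced[OF eb])
  note vb = equivariant_bundleD(1)[OF ind]
  obtain J :: "'m \<times> 'e \<Rightarrow> 'e" where J: "inj_on J (topspace (total ?\<xi>))"
    using inj_on_total_space[OF vb j] by blast
  have iso: "equivariant_iso G X ?\<xi> (transported J ?\<xi>) J"
    by (rule equivariant_iso_transported[OF J])
  have "equivariant_bundle GN Y \<psi> (res ?\<xi>)"
    by (rule equivariant_bundle_transport[OF equivariant_iso_res_induced[OF eb] eb])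
      (use stable F_topspace in \<open>auto simp: restrict_action_def\<close>)
  then have "equivariant_iso GN Y \<zeta> (res (transported J ?\<xi>)) (J \<circ> (\<lambda>v. (proj \<zeta> v, v)))"
    by (intro equivariant_iso_trans[OF equivariant_iso_res_induced[OF eb] equivariant_iso_res[OF iso ind]]
        equivariant_bundleD(1)[OF eb] equivariant_bundleD(1))
  then show ?thesis
    using equivariant_bundle_transport[OF iso ind action(6)] by blast
qed

end

section \<open>Isotropy of proper quasi-free actions\<close>

lemma (in group) mem_conjugate_subgroup:
  "k \<in> conjugate_subgroup G H g \<longleftrightarrow> (\<exists>h\<in>H. k = g \<otimes> h \<otimes> inv g)"
  by (auto simp: conjugate_subgroup_def l_coset_def r_coset_def)

lemma (in group) card_conjugate_subgroup:
  assumes "H \<subseteq> carrier G" "g \<in> carrier G"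
  shows "card (conjugate_subgroup G H g) = card H"
proof -
  have "conjugate_subgroup G H g = (\<lambda>h. g \<otimes> h \<otimes> inv g) ` H"
    by (auto simp: mem_conjugate_subgroup)
  moreover have "inj_on (\<lambda>h. g \<otimes> h \<otimes> inv g) H"
    using assms by (auto intro!: inj_onI simp: subset_iff)
  ultimately show ?thesis by (simp add: card_image)
qed

lemma (in group) normalizer_iff:
  assumes "H \<subseteq> carrier G"
  shows "g \<in> normalizer G H \<longleftrightarrow> g \<in> carrier G \<and> conjugate_subgroup G H g = H"
  using assms by (simp add: normalizer_def stabilizer_def conjugate_subgroup_def)

text \<open>The closed map \<open>(g, z) \<mapsto> (g z, z)\<close> sends the closed set of pairs with \<open>g x \<noteq> x\<close> to a closed set
  that misses \<open>(x, x)\<close>. No separation axiom is involved.\<close>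

lemma proper_isotropy_neighbourhood:
  assumes proper: "proper_G_space G X \<phi>" and x: "x \<in> topspace X"
  shows "\<exists>W. openin X W \<and> x \<in> W \<and>
    (\<forall>g\<in>carrier G. \<forall>z\<in>W. \<phi> g z = z \<longrightarrow> \<phi> g x = x)"
proof -
  let ?S = "{g \<in> carrier G. \<phi> g x \<noteq> x}"
  let ?f = "\<lambda>(g, x). (\<phi> g x, x)"
  have "closedin (prod_topology (discrete_topology (carrier G)) X) (?S \<times> topspace X)"
    by (simp add: closedin_prod_Times_iff closedin_discrete_topology)
  then have "closedin (prod_topology X X) (?f ` (?S \<times> topspace X))"
    using proper by (simp add: proper_G_space_def proper_map_def closed_map_def)
  then have "openin (prod_topology X X) (topspace (prod_topology X X) - ?f ` (?S \<times> topspace X))"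
    by blast
  moreover have "(x, x) \<in> topspace (prod_topology X X) - ?f ` (?S \<times> topspace X)"
    using x by auto
  ultimately obtain U V where "openin X U" "openin X V" "x \<in> U" "x \<in> V"
    and UV: "U \<times> V \<subseteq> topspace (prod_topology X X) - ?f ` (?S \<times> topspace X)"
    unfolding openin_prod_topology_alt by meson
  moreover have "\<phi> g x = x" if g: "g \<in> carrier G" and z: "z \<in> U \<inter> V" "\<phi> g z = z" for g z
  proof (rule ccontr)
    assume "\<phi> g x \<noteq> x"
    moreover have "z \<in> topspace X" using z \<open>openin X U\<close> openin_subset by blast
    ultimately have "?f (g, z) \<in> ?f ` (?S \<times> topspace X)" using g by blast
    then have "?f (g, z) \<notin> U \<times> V" using UV by (meson DiffD2 subsetD)
    then show False using z by simp
  qed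
  ultimately show ?thesis
    by (intro exI[of _ "U \<inter> V"]) blast
qed

lemma open_slice_normalizer:
  fixes G (structure)
  assumes proper: "proper_G_space G X \<phi>" and H: "subgroup H G" and fin: "finite H"
    and qf: "quasi_free_base G X \<phi> H"
  shows "open_slice G X \<phi> (normalizer G H) (fixed_points (topspace X) \<phi> H)"
proof -
  have gs: "G_space G X \<phi>" using proper by (simp add: proper_G_space_def)
  note A = G_spaceD[OF gs]
  interpret group G by (rule A(1))
  have HG: "H \<subseteq> carrier G" using H by (rule subgroup.subset)
  let ?F = "fixed_points (topspace X) \<phi> H"
  let ?K = "\<lambda>x. {k \<in> carrier G. \<phi> k x = x}"
  have sub: "subgroup (?K x) G" if "x \<in> topspace X" for x
  proof
    show "g \<otimes> h \<in> ?K x" if "g \<in> ?K x" "h \<in> ?K x" for g h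
      using that A(5)[of g h x] \<open>x \<in> topspace X\<close> by simp
    show "inv g \<in> ?K x" if "g \<in> ?K x" for g
      using that A(7)[of g x] \<open>x \<in> topspace X\<close> by simp
  qed (use A(4) that in auto)
  \<comment> \<open>By the covering condition the isotropy group of \<open>x\<close> contains a
    conjugate of \<open>H\<close>. It belongs to the fixing family, in which that conjugate is
    maximal.\<close>
  have conj: "\<exists>g\<in>carrier G. ?K x = conjugate_subgroup G H g \<and> x \<in> fixed_points (topspace X) \<phi> (conjugate_subgroup G H g)"
    if x: "x \<in> topspace X" for x
  proof -
    obtain g where g: "g \<in> carrier G" and xg: "x \<in> fixed_points (topspace X) \<phi> (conjugate_subgroup G H g)"
      using qf x unfolding quasi_free_base_def covered_by_fixed_points_def by blast
    have "conjugate_subgroup G H g \<in> {K \<in> fixing_family G (topspace X) \<phi>. \<forall>L\<in>fixing_family G (topspace X) \<phi>. K \<subseteq> L \<longrightarrow> L = K}"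
      using qf g unfolding quasi_free_base_def unique_maximal_up_to_conjugation_def by blast
    then have max: "subgroup (conjugate_subgroup G H g) G"
      "\<And>L. L \<in> fixing_family G (topspace X) \<phi> \<Longrightarrow> conjugate_subgroup G H g \<subseteq> L \<Longrightarrow> L = conjugate_subgroup G H g"
      by (auto simp: fixing_family_def)
    have "?K x \<in> fixing_family G (topspace X) \<phi>"
      using sub[OF x] x by (auto simp: fixing_family_def fixed_points_def)
    moreover have "conjugate_subgroup G H g \<subseteq> ?K x"
      using xg subgroup.subset[OF max(1)] by (auto simp: fixed_points_def)
    ultimately show ?thesis using max(2) g xg by blast
  qed
  have finK: "finite (?K x)" "card (?K x) = card H" if x: "x \<in> topspace X" for x
  proof -
    obtain g where g: "g \<in> carrier G" "?K x = conjugate_subgroup G H g" using conj[OF x] by blast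
    show "card (?K x) = card H" unfolding g(2) by (rule card_conjugate_subgroup[OF HG g(1)])
    \<comment> \<open>An infinite set has \<open>card\<close> 0, while \<open>card H\<close> is
      positive because \<open>H\<close> is finite and contains the unit.\<close>
    then show "finite (?K x)"
      using fin subgroup.one_closed[OF H] by (metis card_eq_0_iff empty_iff)
  qed
  \<comment> \<open>All isotropy groups have the order of \<open>H\<close>, so one inclusion
    suffices. \<open>KF\<close> starts from the inclusion that defines \<open>F\<close>;
    \<open>FK\<close> starts from the opposite one, which properness provides near a point of
    \<open>F\<close>.\<close>
  have KF: "?K x = H" if "x \<in> ?F" for x
    using that finK[of x] HG by (intro card_subset_eq[symmetric]) (auto simp: fixed_points_def)
  have FK: "x \<in> ?F" if "x \<in> topspace X" "?K x \<subseteq> H" for x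
  proof -
    have "?K x = H" using that finK[of x] fin by (intro card_subset_eq) auto
    then show ?thesis using that by (auto simp: fixed_points_def)
  qed
  show ?thesis
  proof (rule open_slice.intro)
    show "G_space G X \<phi>" by (rule gs)
    show "subgroup (normalizer G H) G" by (rule normalizer_imp_subgroup[OF HG])
    show "openin X ?F"
    proof (subst openin_subopen, intro ballI)
      fix x assume x: "x \<in> ?F"
      then obtain W where W: "openin X W" "x \<in> W" "\<forall>g\<in>carrier G. \<forall>z\<in>W. \<phi> g z = z \<longrightarrow> \<phi> g x = x"
        using proper_isotropy_neighbourhood[OF proper, of x] by (auto simp: fixed_points_def)
      have "W \<subseteq> ?F"
      proof
        fix z assume "z \<in> W"
        then show "z \<in> ?F"
          using W openin_subset[OF W(1)] KF[OF x] by (intro FK) blast+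
      qed
      then show "\<exists>T. openin X T \<and> x \<in> T \<and> T \<subseteq> ?F" using W by blast
    qed
    show "\<exists>g\<in>carrier G. \<phi> (inv g) x \<in> ?F" if x: "x \<in> topspace X" for x
    proof -
      obtain g where g: "g \<in> carrier G" and xg: "x \<in> fixed_points (topspace X) \<phi> (conjugate_subgroup G H g)"
        using conj[OF x] by blast
      have "\<phi> h (\<phi> (inv g) x) = \<phi> (inv g) x" if h: "h \<in> H" for h
      proof -
        have hG: "h \<in> carrier G" using h HG by blast
        have "g \<otimes> h \<otimes> inv g \<in> conjugate_subgroup G H g"
          using h mem_conjugate_subgroup by blast
        then have "\<phi> (g \<otimes> h \<otimes> inv g) x = x"
          using xg by (simp add: fixed_points_def)
        then have "\<phi> (inv g) x = \<phi> (inv g) (\<phi> (g \<otimes> h \<otimes> inv g) x)" by simp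
        also have "\<dots> = \<phi> h (\<phi> (inv g) x)"
          using g hG x A(5,6,7) by simp
        finally show ?thesis by simp
      qed
      then show ?thesis using g x A(6) by (auto simp: fixed_points_def)
    qed
    show "\<phi> g x \<in> ?F" if "g \<in> normalizer G H" "x \<in> ?F" for g x
    proof -
      have g: "g \<in> carrier G" "conjugate_subgroup G H g = H" using that(1) normalizer_iff[OF HG] by auto
      have x: "x \<in> topspace X" using that(2) by (simp add: fixed_points_def)
      have "\<phi> k (\<phi> g x) = \<phi> g x" if "k \<in> H" for k
      proof -
        have "k \<in> conjugate_subgroup G H g" using that g(2) by simp
        then obtain h where h: "h \<in> H" "k = g \<otimes> h \<otimes> inv g"
          using mem_conjugate_subgroup by blast
        then have "h \<in> carrier G" "\<phi> h x = x" using HG \<open>x \<in> ?F\<close> by (auto simp: fixed_points_def)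
        then show ?thesis using h(2) g(1) x A(5,6,7) by simp
      qed
      then show ?thesis using A(6) g x by (simp add: fixed_points_def)
    qed
    show "g \<in> normalizer G H" if g: "g \<in> carrier G" and x: "x \<in> ?F" and gx: "\<phi> g x \<in> ?F" for g x
    proof -
      have xX: "x \<in> topspace X" using x by (simp add: fixed_points_def)
      \<comment> \<open>The conjugate fixes \<open>\<phi> g x\<close>, a point of \<open>F\<close>,
        whose isotropy group is \<open>H\<close>. Equal orders then turn the inclusion into an
        equality.\<close>
      have "conjugate_subgroup G H g \<subseteq> ?K (\<phi> g x)"
      proof
        fix k assume "k \<in> conjugate_subgroup G H g"
        then obtain h where h: "h \<in> H" "k = g \<otimes> h \<otimes> inv g"
          using mem_conjugate_subgroup by blast
        then have "h \<in> carrier G" "\<phi> h x = x" using HG x by (auto simp: fixed_points_def)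
        then show "k \<in> ?K (\<phi> g x)" using h(2) g xX A(5,6,7) by simp
      qed
      then have "conjugate_subgroup G H g = H"
        unfolding KF[OF gx] using card_conjugate_subgroup[OF HG g] fin by (intro card_subset_eq) auto
      then show ?thesis using g normalizer_iff[OF HG] by blast
    qed
  qed
qed

section \<open>Conditions on objects for a bundle over the whole space\<close>

lemma fixing_family_total:
  assumes eb: "equivariant_bundle G X \<phi> \<xi>"
  shows "fixing_family G (topspace (total \<xi>)) (act \<xi>) = fixing_family G (topspace X) \<phi>"
proof -
  note E = equivariant_bundleD[OF eb] and V = vector_bundleD[OF equivariant_bundleD(1)[OF eb]]
  have "fixed_points (topspace (total \<xi>)) (act \<xi>) K \<noteq> {} \<longleftrightarrow> fixed_points (topspace X) \<phi> K \<noteq> {}"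
    if K: "subgroup K G" for K
  proof
    assume "fixed_points (topspace (total \<xi>)) (act \<xi>) K \<noteq> {}"
    then obtain e where e: "e \<in> topspace (total \<xi>)" "\<And>k. k \<in> K \<Longrightarrow> act \<xi> k e = e"
      by (auto simp: fixed_points_def)
    have "\<phi> k (proj \<xi> e) = proj \<xi> e" if "k \<in> K" for k
      using E(4)[of k e] e that subgroup.mem_carrier[OF K] by simp
    then show "fixed_points (topspace X) \<phi> K \<noteq> {}"
      using V(1)[OF e(1)] by (auto simp: fixed_points_def)
  next
    assume "fixed_points (topspace X) \<phi> K \<noteq> {}"
    then obtain x where x: "x \<in> topspace X" "\<And>k. k \<in> K \<Longrightarrow> \<phi> k x = x"
      by (auto simp: fixed_points_def)
    have "act \<xi> k (fzero \<xi> x) = fzero \<xi> x" if "k \<in> K" for k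
      using E(8)[of k x] x that subgroup.mem_carrier[OF K] by simp
    then show "fixed_points (topspace (total \<xi>)) (act \<xi>) K \<noteq> {}"
      using V(2)[OF x(1)] by (auto simp: fixed_points_def)
  qed
  then show ?thesis by (auto simp: fixing_family_def)
qed

text \<open>The action of \<open>inv g\<close> moves a point fixed by the conjugate to one fixed by
  \<open>H\<close>. The projection of the latter is fixed by \<open>H\<close> as well, so the
  hypothesis over the fixed point set applies, and \<open>g\<close> carries the zero section back to
  itself.\<close>

lemma fixed_only_in_zero_section_conjugate:
  fixes G (structure)
  assumes eb: "equivariant_bundle G X \<phi> \<xi>" and gs: "G_space G X \<phi>" and H: "subgroup H G"
    and zero_only: "fixed_only_in_zero_section (restrict_to_base \<xi> (fixed_points (topspace X) \<phi> H)) H"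
    and g: "g \<in> carrier G"
  shows "fixed_only_in_zero_section \<xi> (conjugate_subgroup G H g)"
  unfolding fixed_only_in_zero_section_def
proof
  note E = equivariant_bundleD[OF eb] and V = vector_bundleD[OF equivariant_bundleD(1)[OF eb]]
  note A = G_spaceD[OF E(2)]
  interpret group G by (rule A(1))
  define F where "F = fixed_points (topspace X) \<phi> H"
  fix e assume "e \<in> fixed_points (topspace (total \<xi>)) (act \<xi>) (conjugate_subgroup G H g)"
  then have e: "e \<in> topspace (total \<xi>)"
    and "\<And>k. k \<in> conjugate_subgroup G H g \<Longrightarrow> act \<xi> k e = e"
    by (auto simp: fixed_points_def)
  then have fixed: "\<And>h. h \<in> H \<Longrightarrow> act \<xi> (g \<otimes> h \<otimes> inv g) e = e"
    using mem_conjugate_subgroup by blast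
  define e' where "e' = act \<xi> (inv g) e"
  have e': "e' \<in> topspace (total \<xi>)" "act \<xi> g e' = e" using e g E(5) A(8) by (auto simp: e'_def)
  have fixed': "act \<xi> h e' = e'" if h: "h \<in> H" for h
  proof -
    have hG: "h \<in> carrier G" using h subgroup.mem_carrier[OF H] by blast
    have "e' = act \<xi> (inv g) (act \<xi> (g \<otimes> h \<otimes> inv g) e)" using fixed[OF h] by (simp add: e'_def)
    also have "\<dots> = act \<xi> h e'" using e g hG A(5,6,7) by (simp add: e'_def)
    finally show ?thesis by simp
  qed
  have "\<phi> h (proj \<xi> e') = proj \<xi> e'" if "h \<in> H" for h
    using E(4)[OF subgroup.mem_carrier[OF H that] e'(1)] fixed'[OF that] by simp
  then have pe': "proj \<xi> e' \<in> F"
    using V(1)[OF e'(1)] by (simp add: F_def fixed_points_def)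
  then have "e' \<in> fixed_points (topspace (total (restrict_to_base \<xi> F))) (act (restrict_to_base \<xi> F)) H"
    using e'(1) fixed' by (simp add: fixed_points_def restrict_action_def)
  then have "e' = fzero \<xi> (proj \<xi> e')"
    using zero_only unfolding F_def[symmetric] fixed_only_in_zero_section_def by simp
  then have "e = act \<xi> g (fzero \<xi> (proj \<xi> e'))" using e' by simp
  also have "\<dots> = fzero \<xi> (\<phi> g (proj \<xi> e'))"
    using E(8)[OF g V(1)[OF e'(1)]] G_spaceD(6)[OF gs g V(1)[OF e'(1)]] by simp
  also have "\<phi> g (proj \<xi> e') = proj \<xi> e" using E(4)[OF g e'(1)] e' by simp
  finally show "e = fzero \<xi> (proj \<xi> e)" .
qed

section \<open>Restriction to the fixed point set as an equivalence\<close>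

theorem theorem3:
  fixes G :: "'g monoid"
    and X :: "'m topology"
    and \<phi> :: "'g \<Rightarrow> 'm \<Rightarrow> 'm"
    and H :: "'g set"
    and \<rho> :: "('k, 'g) rep_data"
  assumes "proper_G_space G X \<phi>"
    and "subgroup H G" and "finite H"
    and "quasi_free_base G X \<phi> H"
    and "representation_data (subgroup_of G H) \<rho>"
    and "\<exists>j :: 'm \<times> complex \<Rightarrow> 'e. inj j"
  shows "equivalent_categories
           (Vect_tilde G X \<phi> H \<rho> :: (('e, 'm, 'g) gbundle, 'e \<Rightarrow> 'e) cat)
           (Vect_normalizer G X \<phi> H \<rho> :: (('e, 'm, 'g) gbundle, 'e \<Rightarrow> 'e) cat)"
proof -
  define F where "F = fixed_points (topspace X) \<phi> H"
  interpret open_slice G X \<phi> "normalizer G H" F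
    unfolding F_def by (rule open_slice_normalizer[OF assms(1-4)])
  obtain j :: "'m \<times> complex \<Rightarrow> 'e" where j: "inj j" using assms(6) by blast
  have HG: "H \<subseteq> carrier G" using assms(2) by (rule subgroup.subset)
  define ON :: "('e, 'm, 'g) gbundle set" where
    "ON = {\<xi>. equivariant_bundle GN Y \<psi> \<xi> \<and> quasi_free_normal GN Y \<psi> H \<and>
         fixed_only_in_zero_section \<xi> H \<and> has_type GN Y \<psi> H \<rho> \<xi>}"
  have N: "Vect_normalizer G X \<phi> H \<rho> = bundle_cat GN Y ON"
    by (simp add: Vect_normalizer_def Vect_normal_def ON_def F_def Let_def)
  define OT :: "('e, 'm, 'g) gbundle set" where
    "OT = {\<xi>. equivariant_bundle G X \<phi> \<xi> \<and>
         covered_by_fixed_points G (topspace X) \<phi> H \<and>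
         (\<forall>g\<in>carrier G. fixed_only_in_zero_section \<xi> (conjugate_subgroup G H g)) \<and>
         unique_maximal_up_to_conjugation G (topspace (total \<xi>)) (act \<xi>) H \<and> res \<xi> \<in> ON}"
  have T: "Vect_tilde G X \<phi> H \<rho> = bundle_cat G X OT"
    by (simp add: Vect_tilde_def N OT_def F_def)
  have OT: "equivariant_bundle G X \<phi> \<xi>" "res \<xi> \<in> ON" if "\<xi> \<in> OT" for \<xi> using that by (auto simp: OT_def)
  have ON: "equivariant_bundle GN Y \<psi> \<zeta>" if "\<zeta> \<in> ON" for \<zeta> using that by (simp add: ON_def)
  have \<psi>: "\<psi> g y \<in> topspace Y" if "g \<in> carrier GN" "y \<in> topspace Y" for g y
    using that stable F_topspace by (auto simp: restrict_action_def)
  let ?E = "\<lambda>\<xi>. {e \<in> topspace (total \<xi>). proj \<xi> e \<in> F}"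
  let ?C = "bundle_cat G X OT" and ?D = "bundle_cat GN Y ON"
  show ?thesis
    unfolding T N
  proof (rule fully_faithful_ess_surj_imp_equivalent[where ?F0.0 = res and ?F1.0 = "\<lambda>\<xi> \<zeta> f. restrict f (?E \<xi>)"])
    show "category ?C" by (rule category_bundle_cat[OF OT(1)])
    show "category ?D" by (rule category_bundle_cat[OF ON])
    show "is_functor ?C ?D res (\<lambda>\<xi> \<zeta> f. restrict f (?E \<xi>))"
      unfolding is_functor_def bundle_cat_simps restrict_to_base_simps(1)
    proof (intro conjI ballI)
      fix \<xi> \<zeta> \<chi> f g assume \<xi>: "\<xi> \<in> OT" and f: "f \<in> bundle_hom G X \<xi> \<zeta>"
      note f' = bundle_homD[OF f equivariant_bundleD(1)[OF OT(1)[OF \<xi>]]]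
      show "restrict f (?E \<xi>) \<in> bundle_hom GN Y (res \<xi>) (res \<zeta>)"
        by (rule res_bundle_hom[OF OT(1)[OF \<xi>] ON[OF OT(2)[OF \<xi>]] f])
      show "restrict (compose (topspace (total \<xi>)) g f) (?E \<xi>) = compose (?E \<xi>) (restrict g (?E \<zeta>)) (restrict f (?E \<xi>))"
        using f'(4,5) by (auto simp: compose_def fun_eq_iff)
    qed (auto simp: OT(2) fun_eq_iff)
  next
    fix \<xi> \<zeta> assume "\<xi> \<in> Obj ?C" "\<zeta> \<in> Obj ?C"
    then have \<xi>: "\<xi> \<in> OT" and \<zeta>: "\<zeta> \<in> OT" by simp_all
    show "inj_on (\<lambda>f. restrict f (?E \<xi>)) (Hom ?C \<xi> \<zeta>)"
      unfolding bundle_cat_simps by (rule inj_onI) (rule res_faithful[OF OT(1)[OF \<xi>]])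
    show "f \<in> (\<lambda>f. restrict f (?E \<xi>)) ` Hom ?C \<xi> \<zeta>" if "f \<in> Hom ?D (res \<xi>) (res \<zeta>)" for f
      using res_full[OF OT(1)[OF \<xi>] OT(1)[OF \<zeta>] ON[OF OT(2)[OF \<xi>]]] that
      unfolding bundle_cat_simps by (metis (lifting) image_eqI)
  next
    fix \<zeta> assume "\<zeta> \<in> Obj ?D"
    then have \<zeta>: "\<zeta> \<in> ON" by simp
    note eb = ON[OF \<zeta>]
    obtain \<xi> :: "('e, 'm, 'g) gbundle" and f where \<xi>: "equivariant_bundle G X \<phi> \<xi>"
      and iso: "equivariant_iso GN Y \<zeta> (res \<xi>) f"
      using ex_extension[OF eb j] by blast
    have res: "equivariant_bundle GN Y \<psi> (res \<xi>)"
      by (rule equivariant_bundle_transport[OF iso eb \<psi>])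
    \<comment> \<open>\<open>quasi_free_normal\<close> speaks of the base only, so it passes from
      \<open>\<zeta>\<close> to \<open>res \<xi>\<close>; the inclusion of \<open>H\<close> in the
      normalizer is read off it too.\<close>
    have "normal H GN" using \<zeta> by (simp add: ON_def quasi_free_normal_def)
    then have HN: "H \<subseteq> carrier GN" by (rule subgroup.subset[OF normal_imp_subgroup])
    have zero_only: "fixed_only_in_zero_section (res \<xi>) H"
      by (rule fixed_only_in_zero_section_transport[OF iso eb _ HN]) (use \<zeta> in \<open>simp add: ON_def\<close>)
    have "has_type GN Y \<psi> H \<rho> (res \<xi>)"
      by (rule has_type_transport[OF iso eb \<psi> HN])
        (use \<zeta> assms(5) in \<open>simp_all add: ON_def representation_data_def\<close>)
    with res zero_only \<zeta> have resON: "res \<xi> \<in> ON" by (simp add: ON_def)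
    have "fixed_only_in_zero_section \<xi> (conjugate_subgroup G H g)" if "g \<in> carrier G" for g
      by (rule fixed_only_in_zero_section_conjugate[OF \<xi> G_space assms(2) zero_only[unfolded F_def] that])
    moreover have "unique_maximal_up_to_conjugation G (topspace (total \<xi>)) (act \<xi>) H"
      using assms(4) fixing_family_total[OF \<xi>]
      by (simp add: quasi_free_base_def unique_maximal_up_to_conjugation_def)
    ultimately have "\<xi> \<in> OT"
      using \<xi> resON assms(4) by (simp add: OT_def quasi_free_base_def)
    \<comment> \<open>Essential surjectivity asks for an arrow towards \<open>\<zeta>\<close>, hence
      the inverse of \<open>iso\<close>.\<close>
    moreover have "cat_iso ?D (res \<xi>) \<zeta> (restrict (inv_into (topspace (total \<zeta>)) f) (topspace (total (res \<xi>))))"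
      by (rule equivariant_iso_cat_iso[OF equivariant_iso_sym[OF iso eb] res eb])
    ultimately show "\<exists>\<xi>\<in>Obj ?C. \<exists>f. cat_iso ?D (res \<xi>) \<zeta> f"
      by auto
  qed
qed

end
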